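(* We have $$\sum_{k, l \ge 0} \Big( \sum_{\mathbf k \in I_0(k, l, l)} \zeta^{t}_{q}(\mathbf k) \Big) u_1^{k-2l} u_3^l = \exp \left\{ \sum_{n=2}^{\infty} \zeta_{q}(n) \sum_{m=0}^{\infty} \frac{(q-1)^m}{m+n} (w_1^{m+n} + w_2^{m+n} -z_1^{m+n} - z_2^{m+n}) \right\} -1,$$ where $z_1,z_2,w_1,w_2$ are determined by $z_1+z_2=u_1-(1-t)(1-q)u_3$, $z_1z_2=(1-t)u_3$, $w_1+w_2=u_1+t(1-q)u_3$, $w_1w_2=-tu_3$.
   Context: $q$ is a formal parameter, $[n]=(1-q^n)/(1-q)$. For an index $\mathbf k=(k_1,\dots,k_l)$ of positive integers: weight $k_1+\dots+k_l$, depth $l$, $1$-height $\#\{j:k_j\ge2\}$; admissible means $k_1\ge2$. $I_0(k,l,h)$ is the set of admissible indices of weight $k$, depth $l$ and $1$-height $h$ (an empty inner sum is $0$). $\zeta_q(\mathbf k)=\sum_{m_1>\cdots>m_l\ge1}\prod_j q^{(k_j-1)m_j}/[m_j]^{k_j}$, and $\zeta^t_q(\mathbf k)=\sum_{\mathbf p}(1-q)^{\mathrm{wt}(\mathbf k)-\mathrm{wt}(\mathbf p)}\zeta_q(\mathbf p)t^{l-\mathrm{dep}(\mathbf p)}$, where $\mathbf p$ runs over indices $(k_1\,\square\cdots\square\,k_l)$ with each $\square$ filled by ``$,$'', ``$+$'' or ``$-1+$'' (neighbouring $a,b$ replaced by $a+b-1$). *)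

theory Defs
  imports
    "HOL-Analysis.Infinite_Sum"
    "HOL-Computational_Algebra.Computational_Algebra"
    "HOL-Algebra.Algebraic_Closure_Type"
begin

definition is_index :: "nat list \<Rightarrow> bool" where
  "is_index ks \<longleftrightarrow> (\<forall>k\<in>set ks. 1 \<le> k)"

abbreviation weight :: "nat list \<Rightarrow> nat" where
  "weight ks \<equiv> sum_list ks"

abbreviation depth :: "nat list \<Rightarrow> nat" where
  "depth ks \<equiv> length ks"

definition one_height :: "nat list \<Rightarrow> nat" where
  "one_height ks = card {j. j < length ks \<and> 2 \<le> ks ! j}"

text \<open>The empty index has no first entry, so it is not admissible.\<close>

definition admissible :: "nat list \<Rightarrow> bool" where
  "admissible ks \<longleftrightarrow> ks \<noteq> [] \<and> 2 \<le> hd ks"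

definition I0 :: "nat \<Rightarrow> nat \<Rightarrow> nat \<Rightarrow> nat list set" where
  "I0 k l h = {ks. is_index ks \<and> admissible ks \<and>
                   weight ks = k \<and> depth ks = l \<and> one_height ks = h}"

text \<open>The parameter $q$ is the indeterminate \<^term>\<open>fps_X :: rat fps\<close>.\<close>

definition q_num :: "nat \<Rightarrow> rat fps" where
  "q_num n = (1 - fps_X ^ n) / (1 - fps_X)"

text \<open>The sum is taken in the $q$-adic topology of the type \<^typ>\<open>rat fps\<close>.\<close>

definition zeta_q :: "nat list \<Rightarrow> rat fps" where
  "zeta_q ks =
     infsum (\<lambda>ms. \<Prod>j<length ks. fps_X ^ ((ks ! j - 1) * ms ! j) / q_num (ms ! j) ^ (ks ! j))
       {ms :: nat list. length ms = length ks \<and> sorted_wrt (>) ms \<and> (\<forall>m\<in>set ms. 1 \<le> m)}"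

datatype filling = Comma | Plus | Minus_one_plus

fun fill :: "nat list \<Rightarrow> filling list \<Rightarrow> nat list" where
  "fill (a # b # ks) (Comma # fs) = a # fill (b # ks) fs"
| "fill (a # b # ks) (Plus # fs) = fill ((a + b) # ks) fs"
| "fill (a # b # ks) (Minus_one_plus # fs) = fill ((a + b - 1) # ks) fs"
| "fill ks fs = ks"

text \<open>
  The interpolation parameter $t$ is the indeterminate of the type \<^typ>\<open>rat fps poly\<close>.  The sum
  ranges over the fillings themselves: different fillings may produce the same index (for instance
  the two fillings $a + b - 1 + c$ and $a - 1 + b + c$), and then each of them contributes.
\<close>

definition zeta_qt :: "nat list \<Rightarrow> rat fps poly" where
  "zeta_qt ks =
     (\<Sum>fs \<in> {fs :: filling list. length fs = length ks - 1}.
        monom ((1 - fps_X) ^ (weight ks - weight (fill ks fs)) * zeta_q (fill ks fs))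
          (depth ks - depth (fill ks fs)))"

text \<open>
  The ring $\mathbf{Q}[[q]][t][[u_1,u_3]]$: the inner series variable is $u_1$, the outer one is
  $u_3$, so the coefficient of $u_1^a u_3^b$ in $F$ is \<open>F $ b $ a\<close>.
\<close>

type_synonym ser = "rat fps poly fps fps"

definition cst :: "rat fps poly \<Rightarrow> ser" where
  "cst c = fps_const (fps_const c)"

definition rat_cst :: "rat \<Rightarrow> ser" where
  "rat_cst r = cst [:fps_const r:]"

definition q_ser :: ser where
  "q_ser = cst [:fps_X:]"

definition t_ser :: ser where
  "t_ser = cst [:0, 1:]"

definition u1 :: ser where
  "u1 = fps_const fps_X"

definition u3 :: ser where
  "u3 = fps_X"

text \<open>
  Sum of a family of series in which every monomial $u_1^a u_3^b$ occurs in only finitely many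
  members.  The topology of the type class instance on \<^typ>\<open>ser\<close> is not suitable for this purpose,
  because it is the $u_3$-adic one, with discrete coefficients.
\<close>

definition formal_sum :: "('i \<Rightarrow> ser) \<Rightarrow> 'i set \<Rightarrow> ser" where
  "formal_sum f A =
     Abs_fps (\<lambda>b. Abs_fps (\<lambda>a. \<Sum>i \<in> {i \<in> A. f i $ b $ a \<noteq> 0}. f i $ b $ a))"

text \<open>Only meaningful for series with zero constant term.\<close>

definition exp_ser :: "ser \<Rightarrow> ser" where
  "exp_ser F = formal_sum (\<lambda>n. rat_cst (1 / fact n) * F ^ n) UNIV"

text \<open>
  These are roots of quadratic polynomials over \<^typ>\<open>ser\<close> that have no roots in \<^typ>\<open>ser\<close> itself;
  they live in a commutative ring extension \<open>\<iota>\<close> of \<^typ>\<open>ser\<close>.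
\<close>

definition ring_embedding :: "('a :: comm_ring_1 \<Rightarrow> 'b :: comm_ring_1) \<Rightarrow> bool" where
  "ring_embedding \<iota> \<longleftrightarrow> inj \<iota> \<and> \<iota> 1 = 1 \<and>
     (\<forall>x y. \<iota> (x + y) = \<iota> x + \<iota> y) \<and> (\<forall>x y. \<iota> (x * y) = \<iota> x * \<iota> y)"

definition zw_system :: "(ser \<Rightarrow> 'r :: comm_ring_1) \<Rightarrow> 'r \<Rightarrow> 'r \<Rightarrow> 'r \<Rightarrow> 'r \<Rightarrow> bool" where
  "zw_system \<iota> z1 z2 w1 w2 \<longleftrightarrow>
     z1 + z2 = \<iota> (u1 - (1 - t_ser) * (1 - q_ser) * u3) \<and>
     z1 * z2 = \<iota> ((1 - t_ser) * u3) \<and>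
     w1 + w2 = \<iota> (u1 + t_ser * (1 - q_ser) * u3) \<and>
     w1 * w2 = \<iota> (- (t_ser * u3))"

text \<open>Such an extension exists, namely an algebraic closure of the field of fractions.\<close>

lemma quadratic_roots_exist:
  fixes s p :: "'a :: alg_closed_field"
  shows "\<exists>x y. x + y = s \<and> x * y = p"
proof -
  have "\<exists>x. poly [:p, - s, 1:] x = 0"
    by (rule alg_closed_imp_poly_has_root) simp
  then obtain x where "p + x * (x - s) = 0"
    by (auto simp: algebra_simps)
  then have "x + (s - x) = s \<and> x * (s - x) = p"
    by (simp add: algebra_simps add_eq_0_iff)
  then show ?thesis by blast
qed

lemma zw_system_exists:
  "\<exists>(\<iota> :: ser \<Rightarrow> ser fract alg_closure) z1 z2 w1 w2.
     ring_embedding \<iota> \<and> zw_system \<iota> z1 z2 w1 w2"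
proof -
  define \<iota> :: "ser \<Rightarrow> ser fract alg_closure" where "\<iota> = (\<lambda>x. to_ac (Fract x 1))"
  have "ring_embedding \<iota>"
    by (auto simp: ring_embedding_def \<iota>_def inj_def eq_fract One_fract_def [symmetric]
        simp flip: to_ac_add to_ac_mult)
  then show ?thesis
    unfolding zw_system_def using quadratic_roots_exist by metis
qed

end

theory Submission
  imports Defs
begin

text \<open>
  Put \<open>x\<^sub>m = q\<^sup>m / [m]\<close>, so that \<open>q\<^bsup>(k-1)m\<^esup> / [m]\<^sup>k = x\<^sub>m\<^bsup>k-1\<^esup> (x\<^sub>m + 1 - q)\<close>.  Merging two entries
  at the same \<open>m\<close> by ``$+$'' and by ``$-1+$'' (the latter with the factor \<open>1 - q\<close>) adds up to the product
  of the two factors; hence \<open>\<zeta>\<^sup>t\<^sub>q\<close> is a sum over weakly decreasing sequences, in which each equality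
  carries a factor \<open>t\<close>, and one plus the generating series is the product over \<open>m\<close> of
  \<open>(1 - z\<^sub>1 x\<^sub>m) (1 - z\<^sub>2 x\<^sub>m) / ((1 - w\<^sub>1 x\<^sub>m) (1 - w\<^sub>2 x\<^sub>m))\<close>.  The logarithm of the \<open>m\<close>-th factor is
  \<open>\<Sum>\<^sub>N P(N) x\<^sub>m\<^sup>N / N\<close> with \<open>P(N) = w\<^sub>1\<^sup>N + w\<^sub>2\<^sup>N - z\<^sub>1\<^sup>N - z\<^sub>2\<^sup>N\<close>.  On the other side, summing over \<open>n\<close>
  first, the exponent telescopes to \<open>\<Sum>\<^sub>m \<Sum>\<^sub>N P(N) (x\<^sub>m\<^sup>N - (q-1)\<^bsup>N-1\<^esup> x\<^sub>m) / N\<close>, and the correction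
  \<open>\<Sum>\<^sub>N P(N) (q-1)\<^sup>N / N\<close> is the logarithm of the above ratio at \<open>x = q - 1\<close>, where the ratio is \<open>1\<close>.

  Convergence is avoided by working with \<open>m \<le> M\<close> and with congruences modulo \<open>q\<^bsup>M+1\<^esup>\<close> and modulo
  terms of total degree at least \<open>d\<close> in \<open>u\<^sub>1, u\<^sub>3\<close>.
\<close>

subsection \<open>Congruences of double power series\<close>

text \<open>\<open>d\<close> truncates by total degree, \<open>c\<close> acts on coefficients:
  \<open>0 dvd x\<close> forces \<open>x = 0\<close>, so \<open>c = 0\<close> means equality below
  degree \<open>d\<close>, while \<open>c = [:fps_X ^ Suc M:]\<close> adds a q-adic
  truncation.\<close>

definition cong_upto :: "nat \<Rightarrow> 'a::comm_ring_1 \<Rightarrow> 'a fps fps \<Rightarrow> 'a fps fps \<Rightarrow> bool" where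
  "cong_upto d c F G \<longleftrightarrow> (\<forall>b a. a + b < d \<longrightarrow> c dvd F $ b $ a - G $ b $ a)"

abbreviation order_ge :: "nat \<Rightarrow> 'a::comm_ring_1 fps fps \<Rightarrow> bool" where
  "order_ge d F \<equiv> cong_upto d 0 F 0"

lemma cong_upto_refl [simp]: "cong_upto d c F F"
  by (simp add: cong_upto_def)

lemma cong_upto_minus_iff: "cong_upto d c F G \<longleftrightarrow> cong_upto d c (F - G) 0"
  by (simp add: cong_upto_def)

lemma cong_upto_uminus: "cong_upto d c F F' \<Longrightarrow> cong_upto d c (- F) (- F')"
  unfolding cong_upto_def
proof (intro allI impI)
  fix b a
  assume "\<forall>b a. a + b < d \<longrightarrow> c dvd F $ b $ a - F' $ b $ a" "a + b < d"
  then have "c dvd - (F $ b $ a - F' $ b $ a)"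
    unfolding dvd_minus_iff by blast
  then show "c dvd (- F) $ b $ a - (- F') $ b $ a" by simp
qed

lemma cong_upto_sym: "cong_upto d c F G \<Longrightarrow> cong_upto d c G F"
  using cong_upto_uminus[of d c "F - G" 0] by (simp add: cong_upto_def)

lemma cong_upto_trans [trans]:
  assumes "cong_upto d c F G" "cong_upto d c G H"
  shows "cong_upto d c F H"
  unfolding cong_upto_def
proof (intro allI impI)
  fix b a :: nat
  assume "a + b < d"
  then have "c dvd (F $ b $ a - G $ b $ a) + (G $ b $ a - H $ b $ a)"
    using assms unfolding cong_upto_def by (intro dvd_add) blast+
  then show "c dvd F $ b $ a - H $ b $ a" by simp
qed

lemma cong_upto_weaken: "cong_upto d 0 F G \<Longrightarrow> cong_upto d c F G"
  by (simp add: cong_upto_def)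

lemma cong_upto_mono: "cong_upto e c F G \<Longrightarrow> d \<le> e \<Longrightarrow> cong_upto d c F G"
  by (simp add: cong_upto_def)

lemma cong_upto_add: "cong_upto d c F F' \<Longrightarrow> cong_upto d c G G' \<Longrightarrow> cong_upto d c (F + G) (F' + G')"
  unfolding cong_upto_def by (simp add: add_diff_add)

lemma cong_upto_diff: "cong_upto d c F F' \<Longrightarrow> cong_upto d c G G' \<Longrightarrow> cong_upto d c (F - G) (F' - G')"
  using cong_upto_add[of d c F F' "- G" "- G'"] cong_upto_uminus[of d c G G'] by simp

lemma cong_upto_sum: "(\<And>i. i \<in> S \<Longrightarrow> cong_upto d c (f i) (g i)) \<Longrightarrow> cong_upto d c (sum f S) (sum g S)"
  by (induction S rule: infinite_finite_induct) (auto intro: cong_upto_add)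

lemma fps_fps_mult_nth:
  "(F * G) $ b $ a = (\<Sum>j=0..b. \<Sum>i=0..a. F $ j $ i * G $ (b - j) $ (a - i))"
  by (simp add: fps_mult_nth fps_sum_nth)

lemma cong_upto_mult_0:
  assumes "cong_upto d c F 0"
  shows "cong_upto d c (F * G) 0"
  using assms by (auto simp: cong_upto_def fps_fps_mult_nth intro!: dvd_sum dvd_mult2)

lemma cong_upto_mult:
  assumes "cong_upto d c F F'" "cong_upto d c G G'"
  shows "cong_upto d c (F * G) (F' * G')"
proof -
  have "cong_upto d c ((F - F') * G + (G - G') * F') (0 + 0)"
    using assms cong_upto_minus_iff by (intro cong_upto_add cong_upto_mult_0) blast+
  then show ?thesis
    by (subst cong_upto_minus_iff) (simp add: algebra_simps)
qed

lemma cong_upto_power: "cong_upto d c F G \<Longrightarrow> cong_upto d c (F ^ n) (G ^ n)"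
  by (induction n) (auto intro: cong_upto_mult)

lemma order_ge_mult:
  assumes "order_ge d F" "order_ge e G"
  shows "order_ge (d + e) (F * G)"
  unfolding cong_upto_def
proof (intro allI impI)
  fix b a :: nat
  assume ab: "a + b < d + e"
  have "F $ j $ i * G $ (b - j) $ (a - i) = 0" if "j \<le> b" "i \<le> a" for j i
  proof (cases "i + j < d")
    case True
    then show ?thesis using assms(1) by (auto simp: cong_upto_def)
  next
    case False
    then have "(a - i) + (b - j) < e" using ab that by linarith
    then show ?thesis using assms(2) by (auto simp: cong_upto_def)
  qed
  then show "0 dvd (F * G) $ b $ a - 0 $ b $ a"
    by (simp add: fps_fps_mult_nth)
qed

lemma order_ge_power: "order_ge 1 F \<Longrightarrow> order_ge n (F ^ n)"
proof (induction n)
  case (Suc n)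
  then show ?case using order_ge_mult[of 1 F n "F ^ n"] by simp
qed (simp add: cong_upto_def)

lemma order_ge_mult_left: "order_ge d F \<Longrightarrow> order_ge d (G * F)"
  using cong_upto_mult_0[of d 0 F G] by (simp add: mult.commute)

lemma order_ge_sum: "(\<And>i. i \<in> S \<Longrightarrow> order_ge d (f i)) \<Longrightarrow> order_ge d (sum f S)"
  using cong_upto_sum[of S d 0 f "\<lambda>_. 0"] by simp

text \<open>Members outside \<open>S\<close> vanish below degree \<open>d\<close>, so the support
  behind each low coefficient lies in the finite set \<open>S\<close>. This replaces formal sums by
  finite ones.\<close>

lemma formal_sum_cong_upto:
  assumes "finite S" "S \<subseteq> A" and zero: "\<And>i. i \<in> A - S \<Longrightarrow> order_ge d (f i)"
  shows "cong_upto d 0 (formal_sum f A) (sum f S)"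
  unfolding cong_upto_def
proof (intro allI impI)
  fix b a :: nat
  assume "a + b < d"
  then have "{i \<in> A. f i $ b $ a \<noteq> 0} \<subseteq> S"
    using zero by (force simp: cong_upto_def)
  moreover have "\<forall>i\<in>S - {i \<in> A. f i $ b $ a \<noteq> 0}. f i $ b $ a = 0"
    using assms by auto
  ultimately have "(\<Sum>i\<in>{i \<in> A. f i $ b $ a \<noteq> 0}. f i $ b $ a) = (\<Sum>i\<in>S. f i $ b $ a)"
    using \<open>finite S\<close> by (intro sum.mono_neutral_left)
  then show "0 dvd formal_sum f A $ b $ a - sum f S $ b $ a"
    by (simp add: formal_sum_def fps_sum_nth)
qed

section \<open>Constants in the ring of double series\<close>

lemma cst_nth: "cst c $ b $ a = (if a = 0 \<and> b = 0 then c else 0)"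
  by (simp add: cst_def)

lemma cst_mult_nth: "(cst c * F) $ b $ a = c * F $ b $ a"
  by (simp add: cst_def)

lemma cst_add: "cst (c + d) = cst c + cst d"
  and cst_diff: "cst (c - d) = cst c - cst d"
  and cst_mult: "cst (c * d) = cst c * cst d"
  and cst_1 [simp]: "cst 1 = 1"
  by (simp_all add: cst_def)

lemma cst_power: "cst (c ^ n) = cst c ^ n"
  by (induction n) (simp_all add: cst_mult)

lemma cst_sum: "cst (sum f S) = (\<Sum>i\<in>S. cst (f i))"
  by (simp add: fps_eq_iff cst_nth fps_sum_nth)

lemma rat_cst_add: "rat_cst (r + s) = rat_cst r + rat_cst s"
  and rat_cst_uminus: "rat_cst (- r) = - rat_cst r"
  and rat_cst_mult: "rat_cst (r * s) = rat_cst r * rat_cst s"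
  and rat_cst_0 [simp]: "rat_cst 0 = 0"
  and rat_cst_1 [simp]: "rat_cst 1 = 1"
  by (simp_all add: rat_cst_def cst_def one_pCons)

lemma rat_cst_sum: "rat_cst (sum f S) = (\<Sum>i\<in>S. rat_cst (f i))"
  by (induction S rule: infinite_finite_induct) (simp_all add: rat_cst_add)

lemma rat_cst_of_nat: "rat_cst (of_nat n) = of_nat n"
  by (induction n) (simp_all add: rat_cst_add)

subsection \<open>Exponential and logarithm\<close>

definition exp_trunc :: "nat \<Rightarrow> ser \<Rightarrow> ser" where
  "exp_trunc d F = (\<Sum>n<d. rat_cst (1 / fact n) * F ^ n)"

lemma exp_ser_cong_upto:
  assumes "order_ge 1 F"
  shows "cong_upto d 0 (exp_ser F) (exp_trunc d F)"
  unfolding exp_ser_def exp_trunc_def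
proof (rule formal_sum_cong_upto)
  fix n assume "n \<in> UNIV - {..<d}"
  then have "order_ge d (F ^ n)"
    using order_ge_power[OF assms] cong_upto_mono by (metis Diff_iff lessThan_iff not_less)
  then show "order_ge d (rat_cst (1 / fact n) * F ^ n)"
    by (rule order_ge_mult_left)
qed auto

lemma exp_trunc_cong_upto: "cong_upto e c F G \<Longrightarrow> cong_upto e c (exp_trunc d F) (exp_trunc d G)"
  unfolding exp_trunc_def by (intro cong_upto_sum cong_upto_mult cong_upto_power) auto

lemma exp_trunc_0: "d > 0 \<Longrightarrow> exp_trunc d 0 = 1"
  by (cases d) (simp_all add: exp_trunc_def sum.lessThan_Suc_shift del: sum.lessThan_Suc)

text \<open>The triangle i + j < d and the full square differ by pairs with i + j >= d, whose
  products have order at least \<open>d\<close>.\<close>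

lemma truncated_cauchy_product:
  assumes f: "\<And>i. order_ge i (f i)" and g: "\<And>j. order_ge j (g j)"
  shows "cong_upto d 0 (\<Sum>n<d. \<Sum>i\<le>n. f i * g (n - i)) ((\<Sum>i<d. f i) * (\<Sum>j<d. g j))"
proof -
  define h where "h i j = f i * g j" for i j
  define A B where "A = {(i, j). i + j < d}" and "B = {..<d} \<times> {..<d}"
  have AB: "A \<subseteq> B" "finite B" by (auto simp: A_def B_def)
  have "(\<Sum>n<d. \<Sum>i\<le>n. f i * g (n - i)) = (\<Sum>p\<in>A. case_prod h p)"
    by (simp add: h_def [abs_def] A_def sum.triangle_reindex)
  moreover have "(\<Sum>i<d. f i) * (\<Sum>j<d. g j) = (\<Sum>p\<in>B. case_prod h p)"
    by (simp add: h_def [abs_def] B_def sum_product sum.cartesian_product)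
  ultimately have "(\<Sum>i<d. f i) * (\<Sum>j<d. g j) =
      (\<Sum>p\<in>B - A. case_prod h p) + (\<Sum>n<d. \<Sum>i\<le>n. f i * g (n - i))"
    using sum.subset_diff[OF AB, of "case_prod h"] by simp
  moreover have "order_ge d (\<Sum>p\<in>B - A. case_prod h p)"
  proof (rule order_ge_sum)
    fix p assume "p \<in> B - A"
    then obtain i j where p: "p = (i, j)" "d \<le> i + j"
      by (cases p) (auto simp: A_def)
    show "order_ge d (case_prod h p)"
      using cong_upto_mono[OF order_ge_mult[OF f g] p(2)] by (simp add: p h_def)
  qed
  ultimately show ?thesis
    by (simp add: cong_upto_def)
qed

text \<open>By the binomial theorem the n-th term for \<open>F + G\<close> is the Cauchy convolution
  of the terms for \<open>F\<close> and \<open>G\<close>.\<close>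

lemma exp_trunc_add:
  assumes "order_ge 1 F" "order_ge 1 G"
  shows "cong_upto d 0 (exp_trunc d (F + G)) (exp_trunc d F * exp_trunc d G)"
proof -
  define f where "f H i = rat_cst (1 / fact i) * H ^ i" for H i
  have "rat_cst (1 / fact n) * (F + G) ^ n = (\<Sum>i\<le>n. f F i * f G (n - i))" for n
  proof -
    have "rat_cst (1 / fact n) * (of_nat (n choose i) * F ^ i * G ^ (n - i)) = f F i * f G (n - i)"
      if "i \<le> n" for i
    proof -
      have "rat_cst (1 / fact n) * of_nat (n choose i) = rat_cst (1 / fact i) * rat_cst (1 / fact (n - i))"
        unfolding rat_cst_of_nat[symmetric] rat_cst_mult[symmetric]
        by (simp add: binomial_fact[OF that] field_simps)
      then show ?thesis by (simp add: f_def algebra_simps)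
    qed
    then show ?thesis
      by (simp add: binomial_ring sum_distrib_left)
  qed
  then have "exp_trunc d (F + G) = (\<Sum>n<d. \<Sum>i\<le>n. f F i * f G (n - i))"
    by (simp add: exp_trunc_def)
  moreover have "order_ge i (f H i)" if "order_ge 1 H" for H i
    unfolding f_def by (intro order_ge_mult_left order_ge_power that)
  ultimately show ?thesis
    using truncated_cauchy_product[of "f F" "f G" d] assms by (simp add: exp_trunc_def f_def)
qed

text \<open>Truncated evaluation of a rational series at \<open>y\<close>; it carries identities
  such as exp(log(1 + X)) = 1 + X from \<open>rat fps\<close> over to \<open>ser\<close>.\<close>

definition subst_trunc :: "nat \<Rightarrow> rat fps \<Rightarrow> ser \<Rightarrow> ser" where
  "subst_trunc d g y = (\<Sum>k<d. rat_cst (g $ k) * y ^ k)"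

lemma subst_trunc_mult:
  assumes "order_ge 1 y"
  shows "cong_upto d 0 (subst_trunc d (g * h) y) (subst_trunc d g y * subst_trunc d h y)"
proof -
  have "rat_cst ((g * h) $ n) * y ^ n =
      (\<Sum>i\<le>n. (rat_cst (g $ i) * y ^ i) * (rat_cst (h $ (n - i)) * y ^ (n - i)))" for n
  proof -
    have "rat_cst (g $ i * h $ (n - i)) * y ^ n =
        (rat_cst (g $ i) * y ^ i) * (rat_cst (h $ (n - i)) * y ^ (n - i))" if "i \<le> n" for i
      using power_add[of y i "n - i"] that by (simp add: rat_cst_mult mult_ac)
    then show ?thesis
      by (simp add: fps_mult_nth rat_cst_sum sum_distrib_right atLeast0AtMost)
  qed
  moreover have "order_ge i (rat_cst (f $ i) * y ^ i)" for i and f :: "rat fps"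
    by (intro order_ge_mult_left order_ge_power assms)
  ultimately show ?thesis
    unfolding subst_trunc_def
    using truncated_cauchy_product[of "\<lambda>i. rat_cst (g $ i) * y ^ i" "\<lambda>i. rat_cst (h $ i) * y ^ i" d]
    by simp
qed

lemma subst_trunc_power:
  assumes "order_ge 1 y"
  shows "cong_upto d 0 (subst_trunc d (g ^ n) y) (subst_trunc d g y ^ n)"
proof (induction n)
  case 0
  have "subst_trunc d 1 y = 1" if "d > 0"
    using that by (cases d) (simp_all add: subst_trunc_def sum.lessThan_Suc_shift del: sum.lessThan_Suc)
  then show ?case by (cases "d = 0") (simp_all add: cong_upto_def)
next
  case (Suc n)
  then show ?case
    using cong_upto_trans[OF subst_trunc_mult[OF assms] cong_upto_mult[OF cong_upto_refl Suc]] by simp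
qed

text \<open>As \<open>g\<close> has no constant term, \<open>g ^ n\<close> starts in degree
  \<open>n\<close> or later, so coefficients of the composite below \<open>d\<close> involve only
  \<open>n < d\<close>.\<close>

lemma exp_trunc_subst_trunc:
  assumes "order_ge 1 y" "g $ 0 = 0"
  shows "cong_upto d 0 (exp_trunc d (subst_trunc d g y)) (subst_trunc d (fps_exp 1 oo g) y)"
proof -
  have coeff: "(fps_exp 1 oo g) $ k = (\<Sum>n<d. 1 / fact n * g ^ n $ k)" if "k < d" for k
  proof -
    have "(\<Sum>n<d. 1 / fact n * g ^ n $ k) = (\<Sum>n=0..k. 1 / fact n * g ^ n $ k)"
    proof (rule sum.mono_neutral_right)
      show "\<forall>n\<in>{..<d} - {0..k}. 1 / fact n * g ^ n $ k = 0"
        using startsby_zero_power_prefix[OF assms(2)] by auto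
    qed (use that in auto)
    then show ?thesis by (simp add: fps_compose_nth)
  qed
  have "subst_trunc d (fps_exp 1 oo g) y =
      (\<Sum>k<d. \<Sum>n<d. rat_cst (1 / fact n) * (rat_cst (g ^ n $ k) * y ^ k))"
    unfolding subst_trunc_def
    by (rule sum.cong) (simp_all add: coeff rat_cst_sum rat_cst_mult sum_distrib_right mult.assoc del: times_divide_eq_left)
  also have "\<dots> = (\<Sum>n<d. rat_cst (1 / fact n) * subst_trunc d (g ^ n) y)"
    by (subst sum.swap) (simp add: subst_trunc_def sum_distrib_left)
  finally show ?thesis
    unfolding exp_trunc_def
    by (simp add: cong_upto_sum cong_upto_mult cong_upto_sym subst_trunc_power[OF assms(1)])
qed

lemma fps_exp_compose_fps_ln: "fps_exp 1 oo fps_ln 1 = 1 + (fps_X :: rat fps)"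
proof -
  have "(fps_exp 1 - 1) oo fps_ln 1 = (fps_X :: rat fps)"
    using fps_inv_fps_exp_compose(2)[of "1::rat"] by (simp add: fps_ln_fps_exp_inv)
  then show ?thesis
    by (simp add: fps_compose_sub_distrib diff_eq_eq add.commute)
qed

text \<open>This is the truncation of -log(1 - y).\<close>

definition log_trunc :: "nat \<Rightarrow> ser \<Rightarrow> ser" where
  "log_trunc d y = (\<Sum>k=1..<d. rat_cst (1 / of_nat k) * y ^ k)"

lemma order_ge_log_trunc:
  assumes "order_ge 1 y"
  shows "order_ge 1 (log_trunc d y)"
  unfolding log_trunc_def
proof (intro order_ge_sum order_ge_mult_left)
  fix k assume "k \<in> {1..<d}"
  then show "order_ge 1 (y ^ k)"
    using cong_upto_mono[OF order_ge_power[OF assms]] by simp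
qed

lemma exp_trunc_uminus_log_trunc:
  assumes "order_ge 1 y"
  shows "cong_upto d 0 (exp_trunc d (- log_trunc d y)) (1 - y)"
proof -
  have y: "order_ge 1 (- y)"
    using cong_upto_uminus[OF assms] by simp
  \<comment> \<open>The series log(1 + X) is evaluated at -y; the alternating signs cancel up to one
    global minus.\<close>
  have "subst_trunc d (fps_ln 1) (- y) = (\<Sum>k=1..<d. - (rat_cst (1 / of_nat k) * y ^ k))"
    unfolding subst_trunc_def
  proof (rule sum.mono_neutral_cong_right)
    fix k assume "k \<in> {1..<d}"
    then obtain j where k: "k = Suc j" by (cases k) auto
    have "(- 1) ^ j = rat_cst ((- 1) ^ j)"
      by (induction j) (simp_all add: rat_cst_mult rat_cst_uminus)
    then have "(- y) ^ k = - (rat_cst ((- 1) ^ j) * y ^ k)"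
      by (simp add: k power_minus[of y])
    moreover have "rat_cst (fps_ln 1 $ k) * rat_cst ((- 1) ^ j) = rat_cst (1 / of_nat k)"
      unfolding rat_cst_mult[symmetric] by (simp add: fps_ln_nth k flip: power_add mult_2)
    ultimately show "rat_cst (fps_ln 1 $ k) * (- y) ^ k = - (rat_cst (1 / of_nat k) * y ^ k)"
      by (simp flip: mult.assoc)
  next
    show "\<forall>i\<in>{..<d} - {1..<d}. rat_cst (fps_ln 1 $ i) * (- y) ^ i = 0"
    proof
      fix i assume "i \<in> {..<d} - {1..<d}"
      then have "i = 0" by auto
      then show "rat_cst (fps_ln 1 $ i) * (- y) ^ i = 0" by simp
    qed
  qed auto
  also have "\<dots> = - log_trunc d y"
    by (simp add: log_trunc_def sum_negf)
  finally have "cong_upto d 0 (exp_trunc d (- log_trunc d y)) (subst_trunc d (1 + fps_X) (- y))"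
    using exp_trunc_subst_trunc[OF y, of "fps_ln 1" d] by (simp add: fps_exp_compose_fps_ln)
  moreover have "cong_upto d 0 (subst_trunc d (1 + fps_X) (- y)) (1 - y)"
  \<comment> \<open>For \<open>d = 1\<close> the truncation stops before the linear term, but
    \<open>y\<close> itself vanishes below degree 1.\<close>
  proof (cases "d \<le> 1")
    case True
    then consider "d = 0" | "d = 1" by linarith
    then show ?thesis
    proof cases
      case 2
      then show ?thesis using assms by (simp add: subst_trunc_def cong_upto_def)
    qed (simp add: cong_upto_def)
  next
    case False
    then obtain e where "d = Suc (Suc e)" by (metis add_2_eq_Suc le_Suc_ex not_less_eq_eq One_nat_def numeral_2_eq_2)
    then have "subst_trunc d (1 + fps_X) (- y) = 1 - y"
      by (simp add: subst_trunc_def sum.lessThan_Suc_shift del: sum.lessThan_Suc)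
    then show ?thesis by simp
  qed
  ultimately show ?thesis by (rule cong_upto_trans)
qed

text \<open>Since exp(L) exp(-L) = 1 and exp(-L) is \<open>1 - y\<close>, exp(L) serves as the
  inverse of \<open>1 - y\<close> and no series is ever divided.\<close>

lemma exp_trunc_log_trunc:
  assumes "order_ge 1 y"
  shows "cong_upto d 0 (exp_trunc d (log_trunc d y) * (1 - y)) 1"
proof (cases "d = 0")
  case False
  have l: "order_ge 1 (log_trunc d y)" "order_ge 1 (- log_trunc d y)"
    using order_ge_log_trunc[OF assms] cong_upto_uminus by fastforce+
  have "cong_upto d 0 (exp_trunc d (log_trunc d y) * (1 - y))
      (exp_trunc d (log_trunc d y) * exp_trunc d (- log_trunc d y))"
    by (intro cong_upto_mult cong_upto_refl cong_upto_sym[OF exp_trunc_uminus_log_trunc] assms)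
  also have "cong_upto d 0 \<dots> (exp_trunc d (log_trunc d y + - log_trunc d y))"
    by (rule cong_upto_sym[OF exp_trunc_add[OF l]])
  finally show ?thesis using False by (simp add: exp_trunc_0)
qed (simp add: cong_upto_def)

subsection \<open>Power sums of two roots\<close>

text \<open>Newton's recurrence for x^n + y^n with e1 = x + y and e2 = x y. It keeps the power sums
  in the base ring although the roots lie in an extension.\<close>

fun power_sum :: "'a::comm_ring_1 \<Rightarrow> 'a \<Rightarrow> nat \<Rightarrow> 'a" where
  "power_sum e1 e2 0 = 2"
| "power_sum e1 e2 (Suc 0) = e1"
| "power_sum e1 e2 (Suc (Suc n)) = e1 * power_sum e1 e2 (Suc n) - e2 * power_sum e1 e2 n"

lemma power_sum_eq: "power_sum (x + y) (x * y) n = x ^ n + y ^ n"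
  by (induction "x + y" "x * y" n rule: power_sum.induct) (simp_all add: algebra_simps)

lemma ring_embedding_power_sum:
  assumes "ring_embedding \<iota>"
  shows "\<iota> (power_sum e1 e2 n) = power_sum (\<iota> e1) (\<iota> e2) n"
proof -
  have add: "\<iota> (x + y) = \<iota> x + \<iota> y" and mult: "\<iota> (x * y) = \<iota> x * \<iota> y" and one: "\<iota> 1 = 1" for x y
    using assms by (auto simp: ring_embedding_def)
  have diff: "\<iota> (x - y) = \<iota> x - \<iota> y" for x y
    using add[of "x - y" y] by simp
  have two: "\<iota> 2 = 2"
    using add[of 1 1] one by simp
  show ?thesis
    by (induction e1 e2 n rule: power_sum.induct) (simp_all add: mult diff two)
qed

text \<open>Multiplying by \<open>e1\<close> gains one order for one index, by \<open>e2\<close> one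
  order for two indices; the result is n/2 rounded up. Hence the bounds \<open>2 * d\<close>
  below.\<close>

lemma order_ge_power_sum:
  assumes "order_ge 1 e1" "order_ge 1 e2"
  shows "order_ge ((n + 1) div 2) (power_sum e1 e2 n)"
  using assms
proof (induction e1 e2 n rule: power_sum.induct)
  case (3 e1 e2 n)
  have "order_ge ((n + 3) div 2) (e1 * power_sum e1 e2 (Suc n))"
    by (rule cong_upto_mono[OF order_ge_mult[OF 3(3) 3(1)[OF 3(3,4)]]]) simp
  moreover have "order_ge ((n + 3) div 2) (e2 * power_sum e1 e2 n)"
    by (rule cong_upto_mono[OF order_ge_mult[OF 3(4) 3(2)[OF 3(3,4)]]]) simp
  ultimately show ?case
    using cong_upto_diff[where F' = 0 and G' = 0] by (fastforce simp: numeral_3_eq_3)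
qed (simp_all add: cong_upto_def)

text \<open>For e1 = x + y and e2 = x y, \<open>1 - recip_poly e1 e2\<close> is the reversed
  quadratic (1 - x s)(1 - y s).\<close>

abbreviation recip_poly :: "'a::comm_ring_1 \<Rightarrow> 'a \<Rightarrow> 'a poly" where
  "recip_poly e1 e2 \<equiv> [:0, e1, - e2:]"

lemma coeff_recip_poly_mult:
  "coeff (recip_poly e1 e2 * p) 0 = 0"
  "coeff (recip_poly e1 e2 * p) (Suc 0) = e1 * coeff p 0"
  "coeff (recip_poly e1 e2 * p) (Suc (Suc n)) = e1 * coeff p (Suc n) - e2 * coeff p n"
  by (simp_all add: coeff_pCons split: nat.splits)

lemma coeff_recip_poly_power_eq_0: "n < k \<Longrightarrow> coeff (recip_poly e1 e2 ^ k) n = 0"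
proof (induction k arbitrary: n)
  case (Suc k)
  consider "n = 0" | "n = Suc 0" | m where "n = Suc (Suc m)" by (metis nat.exhaust)
  then show ?case
    by cases (use Suc in \<open>simp_all add: coeff_recip_poly_mult del: mult_pCons_left\<close>)
qed simp

lemma order_ge_coeff_recip_poly_power:
  assumes "order_ge 1 e1" "order_ge 1 e2"
  shows "order_ge k (coeff (recip_poly e1 e2 ^ k) n)"
proof (induction k arbitrary: n)
  case 0
  show ?case by (simp add: cong_upto_def)
next
  case (Suc k)
  have *: "order_ge (Suc k) (e1 * coeff (recip_poly e1 e2 ^ k) i)"
      "order_ge (Suc k) (e2 * coeff (recip_poly e1 e2 ^ k) i)" for i
    using order_ge_mult[OF assms(1) Suc] order_ge_mult[OF assms(2) Suc] by simp_all
  consider "n = 0" | "n = Suc 0" | m where "n = Suc (Suc m)" by (metis nat.exhaust)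
  then show ?case
  proof cases
    case (3 m)
    then show ?thesis
      using cong_upto_diff[OF *(1)[of "Suc m"] *(2)[of m]]
      by (simp add: coeff_recip_poly_mult del: mult_pCons_left)
  qed (use * in \<open>simp_all add: coeff_recip_poly_mult del: mult_pCons_left\<close>)
qed

text \<open>The logarithmic derivative of 1/(1 - Y), read coefficientwise: p_(n+1) is the n-th
  coefficient of Y'/(1 - Y), expanded as a geometric series.\<close>

lemma power_sum_Suc_eq_coeff_sum:
  fixes e1 e2 :: "'a::idom"
  defines "Y \<equiv> recip_poly e1 e2"
  shows "power_sum e1 e2 (Suc n) = (\<Sum>k\<le>n. coeff (Y ^ k * pderiv Y) n)"
proof -
  have Y_0: "n < k \<Longrightarrow> coeff (Y ^ k) n = 0" for n k
    unfolding Y_def by (rule coeff_recip_poly_power_eq_0)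
  \<comment> \<open>\<open>h n\<close> is the n-th coefficient of 1/(1 - Y), where powers with k > n
    contribute nothing.\<close>
  define h where "h n = (\<Sum>k\<le>n. coeff (Y ^ k) n)" for n
  have h_0: "h 0 = 1" and h_1: "h (Suc 0) = e1"
    by (simp_all add: h_def Y_def)
  have h_rec: "h (Suc (Suc n)) = e1 * h (Suc n) - e2 * h n" for n
  proof -
    have "h (Suc (Suc n)) = (\<Sum>k\<le>Suc n. coeff (Y ^ Suc k) (Suc (Suc n)))"
      unfolding h_def by (subst sum.atMost_Suc_shift) (simp add: coeff_1)
    also have "\<dots> = (\<Sum>k\<le>Suc n. e1 * coeff (Y ^ k) (Suc n) - e2 * coeff (Y ^ k) n)"
      by (simp add: Y_def coeff_recip_poly_mult del: mult_pCons_left)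
    also have "\<dots> = e1 * h (Suc n) - e2 * (\<Sum>k\<le>Suc n. coeff (Y ^ k) n)"
      unfolding h_def by (simp add: sum_subtractf sum_distrib_left del: sum.atMost_Suc)
    also have "(\<Sum>k\<le>Suc n. coeff (Y ^ k) n) = h n"
      by (simp add: h_def Y_0 del: power_Suc)
    finally show ?thesis .
  qed
  have Y': "pderiv Y = [:e1, - (2 * e2):]"
    by (simp add: Y_def pderiv_pCons)
  have coeff: "coeff (p * pderiv Y) (Suc n) = e1 * coeff p (Suc n) - 2 * e2 * coeff p n" for p n
    by (simp add: Y' mult.commute[of p])
  have sum_coeff: "(\<Sum>k\<le>Suc n. coeff (Y ^ k * pderiv Y) (Suc n)) = e1 * h (Suc n) - 2 * e2 * h n" for n
  proof -
    have "(\<Sum>k\<le>Suc n. coeff (Y ^ k) n) = h n"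
      by (simp add: h_def Y_0 del: power_Suc)
    then show ?thesis
      unfolding coeff h_def
      by (simp add: sum_subtractf sum_distrib_left[symmetric] del: sum.atMost_Suc)
  qed
  \<comment> \<open>Both sides obey the same second-order recurrence, so two initial values
    suffice.\<close>
  have "power_sum e1 e2 (Suc (Suc n)) = e1 * h (Suc n) - 2 * e2 * h n" for n
  proof (induction n rule: induct_nat_012)
    case (ge2 n)
    then show ?case
      unfolding power_sum.simps(3)[of e1 e2 "Suc (Suc n)"] ge2 h_rec by (simp add: algebra_simps)
  qed (simp_all add: h_0 h_1 h_rec algebra_simps)
  then show ?thesis
    by (cases n) (simp_all only: sum_coeff, simp add: Y')
qed

text \<open>These are the coefficients of \<open>\<Sum>\<^sub>n p\<^sub>n s\<^sup>n / n = - log (1 - e\<^sub>1 s + e\<^sub>2 s\<^sup>2)\<close>.\<close>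

lemma power_sum_div_eq_coeff_sum:
  fixes e1 e2 :: ser
  assumes "n > 0"
  shows "rat_cst (1 / of_nat n) * power_sum e1 e2 n =
    (\<Sum>k=1..n. rat_cst (1 / of_nat k) * coeff (recip_poly e1 e2 ^ k) n)"
proof -
  obtain m where n: "n = Suc m" using assms by (cases n) auto
  define Y where "Y = recip_poly e1 e2"
  have inv: "rat_cst (1 / of_nat (Suc k)) * of_nat (Suc k) = 1" for k
    unfolding rat_cst_of_nat[symmetric] rat_cst_mult[symmetric] by simp
  have "rat_cst (1 / of_nat (Suc m)) * coeff (Y ^ k * pderiv Y) m =
      rat_cst (1 / of_nat (Suc k)) * coeff (Y ^ Suc k) (Suc m)" for k
  proof -
    define r s where "r = rat_cst (1 / of_nat (Suc m))" and "s = rat_cst (1 / of_nat (Suc k))"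
    \<comment> \<open>Compares the coefficients of degree \<open>m\<close> in (Y^(k+1))' = (k+1) Y^k
      Y'.\<close>
    have "of_nat (Suc m) * coeff (Y ^ Suc k) (Suc m) = of_nat (Suc k) * coeff (Y ^ k * pderiv Y) m"
      by (metis coeff_pderiv pderiv_power_Suc coeff_smult mult_smult_left)
    then have "r * s * (of_nat (Suc m) * coeff (Y ^ Suc k) (Suc m)) =
        r * s * (of_nat (Suc k) * coeff (Y ^ k * pderiv Y) m)" by simp
    then have "(r * of_nat (Suc m)) * (s * coeff (Y ^ Suc k) (Suc m)) =
        (s * of_nat (Suc k)) * (r * coeff (Y ^ k * pderiv Y) m)" by (simp only: mult_ac)
    then show ?thesis
      unfolding r_def s_def inv by simp
  qed
  then have "rat_cst (1 / of_nat n) * power_sum e1 e2 n =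
      (\<Sum>k\<le>m. rat_cst (1 / of_nat (Suc k)) * coeff (Y ^ Suc k) n)"
    unfolding n power_sum_Suc_eq_coeff_sum Y_def[symmetric] sum_distrib_left by simp
  also have "\<dots> = (\<Sum>k=1..n. rat_cst (1 / of_nat k) * coeff (Y ^ k) n)"
    unfolding n
    by (rule sum.reindex_bij_witness[of _ "\<lambda>k. k - 1" Suc]) auto
  finally show ?thesis unfolding Y_def .
qed

text \<open>Summing over \<open>n\<close> first turns the coefficients of Y^k into the value Y(x)^k.
  The range \<open>2 * d\<close> is long enough: Y^k has degree at most 2k, and for k >= d its
  coefficients have order at least \<open>d\<close>.\<close>

lemma power_sum_series_cong_log_trunc:
  assumes "order_ge 1 e1" "order_ge 1 e2"
  shows "cong_upto d 0 (\<Sum>n=1..<2*d. rat_cst (1 / of_nat n) * power_sum e1 e2 n * x ^ n)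
    (log_trunc d (e1 * x - e2 * x ^ 2))"
proof -
  define Y where "Y = recip_poly e1 e2"
  have "(\<Sum>n=1..<2*d. rat_cst (1 / of_nat n) * power_sum e1 e2 n * x ^ n) =
      (\<Sum>n=1..<2*d. \<Sum>k=1..<2*d. rat_cst (1 / of_nat k) * (coeff (Y ^ k) n * x ^ n))"
  proof (rule sum.cong)
    fix n assume n: "n \<in> {1..<2*d}"
    have "(\<Sum>k=1..n. rat_cst (1 / of_nat k) * (coeff (Y ^ k) n * x ^ n)) =
        (\<Sum>k=1..<2*d. rat_cst (1 / of_nat k) * (coeff (Y ^ k) n * x ^ n))"
    proof (rule sum.mono_neutral_left)
      show "\<forall>k\<in>{1..<2*d} - {1..n}. rat_cst (1 / of_nat k) * (coeff (Y ^ k) n * x ^ n) = 0"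
        by (auto simp: Y_def coeff_recip_poly_power_eq_0 not_le)
    qed (use n in auto)
    then show "rat_cst (1 / of_nat n) * power_sum e1 e2 n * x ^ n =
        (\<Sum>k=1..<2*d. rat_cst (1 / of_nat k) * (coeff (Y ^ k) n * x ^ n))"
      using n by (subst power_sum_div_eq_coeff_sum) (simp_all add: sum_distrib_right mult.assoc Y_def)
  qed simp
  also have "\<dots> = (\<Sum>k=1..<2*d. rat_cst (1 / of_nat k) * (\<Sum>n=1..<2*d. coeff (Y ^ k) n * x ^ n))"
    by (subst sum.swap) (simp add: sum_distrib_left)
  also have "cong_upto d 0 \<dots> (\<Sum>k=1..<2*d. if k < d then rat_cst (1 / of_nat k) * (e1 * x - e2 * x ^ 2) ^ k else 0)"
  proof (rule cong_upto_sum)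
    fix k assume k: "k \<in> {1..<2*d}"
    show "cong_upto d 0 (rat_cst (1 / of_nat k) * (\<Sum>n=1..<2*d. coeff (Y ^ k) n * x ^ n))
        (if k < d then rat_cst (1 / of_nat k) * (e1 * x - e2 * x ^ 2) ^ k else 0)"
    proof (cases "k < d")
      case True
      have "degree Y \<le> 2" by (simp add: Y_def)
      then have deg: "degree (Y ^ k) < 2 * d"
        using degree_power_le[of Y k] True
        by (metis dual_order.strict_trans2 le_trans mult.commute mult_le_mono1 mult_less_cancel1 zero_less_numeral)
      have "poly (Y ^ k) x = (\<Sum>n=1..<2*d. coeff (Y ^ k) n * x ^ n)"
        unfolding poly_altdef
      proof (rule sum.mono_neutral_cong)
        fix n assume "n \<in> {..degree (Y ^ k)} - {1..<2*d}"
        then have "n = 0" using deg by auto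
        then show "coeff (Y ^ k) n * x ^ n = 0"
          using k by (simp add: Y_def coeff_recip_poly_power_eq_0)
      qed (auto intro: coeff_eq_0)
      then show ?thesis
        using True by (simp add: Y_def poly_power algebra_simps power2_eq_square)
    next
      case False
      have "order_ge d (coeff (Y ^ k) n * x ^ n)" for n
        using cong_upto_mono[OF order_ge_coeff_recip_poly_power[OF assms, of k n], of d] False
        by (intro cong_upto_mult_0) (simp add: Y_def)
      then show ?thesis
        using False by (simp add: order_ge_mult_left order_ge_sum)
    qed
  qed
  also have "(\<Sum>k=1..<2*d. if k < d then rat_cst (1 / of_nat k) * (e1 * x - e2 * x ^ 2) ^ k else 0) =
      log_trunc d (e1 * x - e2 * x ^ 2)"
    unfolding log_trunc_def by (rule sum.mono_neutral_cong_right) auto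
  finally show ?thesis .
qed

subsection \<open>Truncated q-zeta values\<close>

lemma fps_X_power_dvd_iff: "fps_X ^ n dvd F \<longleftrightarrow> (\<forall>i<n. F $ i = 0)" for F :: "'a::field fps"
proof
  assume "fps_X ^ n dvd F"
  then show "\<forall>i<n. F $ i = 0" by (auto simp: dvd_def fps_X_power_mult_nth)
next
  assume "\<forall>i<n. F $ i = 0"
  then have "F = fps_X ^ n * fps_shift n F"
    by (intro fps_ext) (auto simp: fps_X_power_mult_nth)
  then show "fps_X ^ n dvd F" by (metis dvd_triv_left)
qed

definition q_pow :: "nat \<Rightarrow> rat fps" where
  "q_pow m = fps_X ^ m / q_num m"

definition zeta_factor :: "nat \<Rightarrow> nat \<Rightarrow> rat fps" where
  "zeta_factor k m = fps_X ^ ((k - 1) * m) / q_num m ^ k"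

lemma q_num_mult: "q_num m * (1 - fps_X) = 1 - fps_X ^ m"
proof -
  have "inverse (1 - fps_X) * (1 - fps_X) = (1 :: rat fps)"
    by (rule inverse_mult_eq_1) simp
  then show ?thesis
    by (simp add: q_num_def fps_divide_unit mult.assoc)
qed

lemma q_num_nth_0:
  assumes "1 \<le> m"
  shows "q_num m $ 0 = 1"
proof -
  have "(q_num m * (1 - fps_X)) $ 0 = (1 - fps_X ^ m :: rat fps) $ 0"
    by (simp only: q_num_mult)
  then show ?thesis using assms by simp
qed

text \<open>Dividing [m](1 - q) = 1 - q^m by [m] gives 1/[m] = x_m + (1 - q); the other k - 1
  factors are x_m each.\<close>

lemma zeta_factor_eq:
  assumes "1 \<le> k" "1 \<le> m"
  shows "zeta_factor k m = q_pow m ^ (k - 1) * (q_pow m + (1 - fps_X))"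
proof -
  obtain j where k: "k = Suc j" using assms(1) by (cases k) auto
  have q0: "q_num m $ 0 = 1" by (rule q_num_nth_0) fact
  define v where "v = inverse (q_num m)"
  have v: "v * q_num m = 1"
    unfolding v_def by (rule inverse_mult_eq_1) (simp add: q0)
  have "v = v * (fps_X ^ m + q_num m * (1 - fps_X))"
    by (simp add: q_num_mult)
  also have "\<dots> = v * fps_X ^ m + (v * q_num m) * (1 - fps_X)"
    by (simp add: algebra_simps)
  finally have sum: "v * fps_X ^ m + (1 - fps_X) = v"
    by (simp add: v)
  have q: "q_pow m = v * fps_X ^ m"
    by (simp add: q_pow_def v_def fps_divide_unit q0 mult.commute)
  have "zeta_factor k m = fps_X ^ (j * m) * v ^ k"
    by (simp add: zeta_factor_def v_def fps_divide_unit fps_inverse_power fps_nth_power_0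
        q0 k del: power_Suc)
  also have "\<dots> = (v * fps_X ^ m) ^ j * v"
    by (simp add: k power_mult_distrib power_mult mult_ac flip: power_mult[of fps_X m j])
  finally show ?thesis
    by (simp add: q sum k)
qed

text \<open>For \<open>k >= 2\<close> at least one factor x_m remains, and q^m divides it. All
  q-adic convergence rests on this.\<close>

lemma fps_X_power_dvd_zeta_factor:
  assumes "2 \<le> k" "1 \<le> m"
  shows "fps_X ^ m dvd zeta_factor k m"
proof -
  have "fps_X ^ m dvd q_pow m"
    by (simp add: q_pow_def fps_divide_unit q_num_nth_0[OF assms(2)])
  then have "fps_X ^ m dvd q_pow m ^ (k - 1)"
    using assms(1) by (intro dvd_trans[OF _ dvd_power]) auto
  then show ?thesis
    using assms by (simp add: zeta_factor_eq)
qed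

text \<open>With x = x_m, both terms on the left share x^(a+b-2) (x + 1 - q), and their cofactors x
  and 1 - q add up to the missing factor.\<close>

lemma zeta_factor_stuffle:
  assumes "1 \<le> a" "1 \<le> b" "1 \<le> m"
  shows "zeta_factor (a + b) m + (1 - fps_X) * zeta_factor (a + b - 1) m =
    zeta_factor a m * zeta_factor b m"
proof -
  obtain i j where "a = Suc i" "b = Suc j"
    using assms by (cases a; cases b) auto
  then show ?thesis
    using assms by (simp add: zeta_factor_eq power_add algebra_simps)
qed

text \<open>The multiple sum restricted to m_1 <= M. Splitting off m_1 = M + 1 later yields one
  factor of the product per step.\<close>

fun zeta_trunc :: "nat \<Rightarrow> nat list \<Rightarrow> rat fps" where
  "zeta_trunc M [] = 1"
| "zeta_trunc 0 (k # ks) = 0"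
| "zeta_trunc (Suc M) (k # ks) = zeta_trunc M (k # ks) + zeta_factor k (Suc M) * zeta_trunc M ks"

definition dec_lists :: "nat \<Rightarrow> nat \<Rightarrow> nat list set" where
  "dec_lists M l = {ms. length ms = l \<and> sorted_wrt (>) ms \<and> set ms \<subseteq> {1..M}}"

lemma finite_dec_lists: "finite (dec_lists M l)"
  by (rule finite_subset[OF _ finite_lists_length_eq[of "{1..M}" l]]) (auto simp: dec_lists_def)

lemma dec_lists_Suc_Suc: "dec_lists (Suc M) (Suc l) = dec_lists M (Suc l) \<union> Cons (Suc M) ` dec_lists M l"
proof (intro equalityI subsetI)
  fix ms assume "ms \<in> dec_lists (Suc M) (Suc l)"
  then obtain m ms' where ms: "ms = m # ms'" "length ms' = l" "sorted_wrt (>) ms'"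
      "\<forall>n\<in>set ms'. n < m" "1 \<le> m" "m \<le> Suc M" "set ms' \<subseteq> {1..Suc M}"
    by (cases ms) (auto simp: dec_lists_def)
  then have "set ms' \<subseteq> {1..M}" by force
  with ms show "ms \<in> dec_lists M (Suc l) \<union> Cons (Suc M) ` dec_lists M l"
    by (cases "m = Suc M") (auto simp: dec_lists_def)
qed (fastforce simp: dec_lists_def)

lemma zeta_trunc_eq_sum:
  "zeta_trunc M ks = (\<Sum>ms\<in>dec_lists M (length ks). \<Prod>j<length ks. zeta_factor (ks ! j) (ms ! j))"
proof (induction M ks rule: zeta_trunc.induct)
  case (1 M)
  have "dec_lists M 0 = {[]}" by (auto simp: dec_lists_def)
  then show ?case by simp
next
  case (2 k ks)
  have "dec_lists 0 (Suc (length ks)) = {}" by (auto simp: dec_lists_def)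
  then show ?case by simp
next
  case (3 M k ks)
  let ?f = "\<lambda>ms. \<Prod>j<length (k # ks). zeta_factor ((k # ks) ! j) (ms ! j)"
  have "(\<Sum>ms\<in>dec_lists (Suc M) (length (k # ks)). ?f ms) =
      (\<Sum>ms\<in>dec_lists M (length (k # ks)). ?f ms) + (\<Sum>ms\<in>Cons (Suc M) ` dec_lists M (length ks). ?f ms)"
    unfolding list.size add_0_right add_Suc_right dec_lists_Suc_Suc
    by (rule sum.union_disjoint) (auto simp: finite_dec_lists, auto simp: dec_lists_def)
  also have "(\<Sum>ms\<in>Cons (Suc M) ` dec_lists M (length ks). ?f ms) =
      zeta_factor k (Suc M) * zeta_trunc M ks"
    by (subst sum.reindex)
      (simp_all add: 3 prod.lessThan_Suc_shift sum_distrib_left del: prod.lessThan_Suc)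
  finally show ?case by (simp add: 3 del: prod.lessThan_Suc)
qed

text \<open>The first exponent is at least 2, so a sequence with m_1 > M contributes a multiple of
  q^(m_1).\<close>

lemma zeta_q_cong_zeta_trunc:
  assumes "\<forall>k\<in>set ks. 2 \<le> k"
  shows "fps_X ^ Suc M dvd zeta_q ks - zeta_trunc M ks"
proof -
  define A where "A = {ms :: nat list. length ms = length ks \<and> sorted_wrt (>) ms \<and> (\<forall>m\<in>set ms. 1 \<le> m)}"
  define f where "f ms = (\<Prod>j<length ks. zeta_factor (ks ! j) (ms ! j))" for ms
  have sub: "dec_lists N (length ks) \<subseteq> A" for N
    by (auto simp: A_def dec_lists_def)
  have zero: "f ms $ n = 0" if ms: "ms \<in> A - dec_lists N (length ks)" and n: "n \<le> N" for ms n N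
  proof -
    from ms obtain m where m: "m \<in> set ms" "N < m"
      by (fastforce simp: A_def dec_lists_def)
    then obtain m0 ms' where ms': "ms = m0 # ms'" by (cases ms) auto
    with ms obtain k ks' where ks': "ks = k # ks'" by (cases ks) (auto simp: A_def)
    have "N < m0" "1 \<le> m0" using ms m ms' by (auto simp: A_def)
    then have "fps_X ^ m0 dvd zeta_factor (ks ! 0) (ms ! 0)"
      using assms ks' ms' by (simp add: fps_X_power_dvd_zeta_factor)
    then have "fps_X ^ m0 dvd f ms"
      unfolding f_def
      by (rule dvd_trans) (rule dvd_prodI[where f = "\<lambda>j. zeta_factor (ks ! j) (ms ! j)"], simp_all add: ks')
    then show ?thesis using \<open>N < m0\<close> n by (simp add: fps_X_power_dvd_iff)
  qed
  have supp: "{ms \<in> A. f ms $ n \<noteq> 0} \<subseteq> dec_lists N (length ks)" if "n \<le> N" for n N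
    using zero[OF _ that] by blast
  define S where "S = Abs_fps (\<lambda>n. \<Sum>ms | ms \<in> A \<and> f ms $ n \<noteq> 0. f ms $ n)"
  \<comment> \<open>Each coefficient receives finitely many contributions, which proves summability
    and so determines the \<open>infsum\<close> in \<open>zeta_q\<close>.\<close>
  have "(f has_sum S) A"
    by (rule has_sum_fpsI) (auto simp: S_def intro: finite_subset[OF supp[OF order_refl] finite_dec_lists])
  then have "zeta_q ks = S"
    unfolding zeta_q_def A_def f_def [abs_def] zeta_factor_def by (rule infsumI)
  moreover have "S $ n = zeta_trunc M ks $ n" if "n < Suc M" for n
  proof -
    have "(\<Sum>ms | ms \<in> A \<and> f ms $ n \<noteq> 0. f ms $ n) = (\<Sum>ms\<in>dec_lists M (length ks). f ms $ n)"
      by (rule sum.mono_neutral_left) (use supp[of n M] that sub[of M] in \<open>auto simp: finite_dec_lists\<close>)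
    then show ?thesis
      by (simp add: S_def zeta_trunc_eq_sum f_def fps_sum_nth)
  qed
  ultimately show ?thesis by (simp add: fps_X_power_dvd_iff del: power_Suc)
qed

subsection \<open>Interpolated sums and their generating series\<close>

lemma sum_filling_Suc:
  "(\<Sum>fs | length fs = Suc n. g fs) =
    (\<Sum>fs | length fs = n. g (Comma # fs)) + (\<Sum>fs | length fs = n. g (Plus # fs)) +
    (\<Sum>fs | length fs = n. g (Minus_one_plus # fs))"
proof -
  have UNIV: "(UNIV :: filling set) = {Comma, Plus, Minus_one_plus}"
    using filling.exhaust by auto
  have fin: "finite {fs :: filling list. length fs = n}"
    using finite_lists_length_eq[of "UNIV :: filling set" n] by (metis (no_types, lifting) UNIV finite.emptyI finite.insertI top_greatest Collect_cong)
  have "{fs. length fs = Suc n} = (\<Union>x\<in>{Comma, Plus, Minus_one_plus}. Cons x ` {fs. length fs = n})"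
    by (auto simp: length_Suc_conv UNIV[symmetric])
  then have "(\<Sum>fs | length fs = Suc n. g fs) =
      (\<Sum>x\<in>{Comma, Plus, Minus_one_plus}. \<Sum>fs\<in>Cons x ` {fs. length fs = n}. g fs)"
    by (simp only:) (rule sum.UNION_disjoint, auto simp: fin)
  then show ?thesis
    by (simp add: sum.reindex add.assoc)
qed

text \<open>Ensures that the natural-number subtractions in the exponents of \<open>zeta_qt\<close>
  are never cut off.\<close>

lemma fill_bounds:
  assumes "is_index ks"
  shows "weight (fill ks fs) \<le> weight ks \<and> depth (fill ks fs) \<le> depth ks"
  using assms
proof (induction ks fs rule: fill.induct)
  case (3 a b ks fs)
  then have "is_index ((a + b - 1) # ks)" by (auto simp: is_index_def)
  from 3(1)[OF this] show ?case by auto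
qed (auto simp: is_index_def)

lemma fill_eq_Nil_iff [simp]: "fill ks fs = [] \<longleftrightarrow> ks = []"
  by (induction ks fs rule: fill.induct) auto

lemma fill_ge_2: "\<forall>k\<in>set ks. 2 \<le> k \<Longrightarrow> \<forall>k\<in>set (fill ks fs). 2 \<le> k"
  by (induction ks fs rule: fill.induct) auto

text \<open>The construction of \<open>zeta_qt\<close> with \<open>zeta_q\<close> as a parameter,
  since the recursion applies it to truncated sums and their pieces.\<close>

definition interpolate :: "(nat list \<Rightarrow> rat fps) \<Rightarrow> nat list \<Rightarrow> rat fps poly" where
  "interpolate \<phi> ks =
     (\<Sum>fs | length fs = length ks - 1.
        monom ((1 - fps_X) ^ (weight ks - weight (fill ks fs)) * \<phi> (fill ks fs))
          (depth ks - depth (fill ks fs)))"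

lemma zeta_qt_eq_interpolate: "zeta_qt = interpolate zeta_q"
  by (simp add: fun_eq_iff zeta_qt_def interpolate_def)

lemma interpolate_Nil [simp]: "interpolate \<phi> [] = [:\<phi> []:]"
  by (simp add: interpolate_def monom_0)

lemma interpolate_single [simp]: "interpolate \<phi> [a] = [:\<phi> [a]:]"
  by (simp add: interpolate_def monom_0)

lemma interpolate_add: "interpolate (\<lambda>ks. \<phi> ks + \<psi> ks) ks = interpolate \<phi> ks + interpolate \<psi> ks"
  by (simp add: interpolate_def distrib_left sum.distrib add_monom[symmetric])

lemma interpolate_cmult: "interpolate (\<lambda>ks. c * \<phi> ks) ks = [:c:] * interpolate \<phi> ks"
  unfolding interpolate_def sum_distrib_left by (simp add: smult_monom mult_ac)

text \<open>The first box decides: a merge lowers the depth by one, giving t, and the merge with -1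
  also lowers the weight by one, giving 1 - q.\<close>

lemma interpolate_Cons_Cons:
  assumes "is_index (a # b # ks)"
  shows "interpolate \<phi> (a # b # ks) =
    interpolate (\<lambda>ps. \<phi> (a # ps)) (b # ks) +
    [:0, 1:] * interpolate \<phi> ((a + b) # ks) +
    [:0, 1:] * ([:1 - fps_X:] * interpolate \<phi> ((a + b - 1) # ks))"
proof -
  have const_mult: "[:c:] * monom d n = monom (c * d) n" for c d :: "rat fps" and n
    by (simp add: smult_monom)
  have X: "[:0, 1:] * monom c n = monom c (Suc n)" for c :: "rat fps" and n
    by (simp add: monom_Suc)
  have idx: "is_index ((a + b) # ks)" "is_index ((a + b - 1) # ks)" "1 \<le> a" "1 \<le> b"
    using assms by (auto simp: is_index_def)
  have plus: "depth (a # b # ks) - depth (fill ((a + b) # ks) fs) =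
      Suc (depth ((a + b) # ks) - depth (fill ((a + b) # ks) fs))" for fs
    using fill_bounds[OF idx(1), of fs] by (simp add: Suc_diff_le)
  have minus: "depth (a # b # ks) - depth (fill ((a + b - 1) # ks) fs) =
      Suc (depth ((a + b - 1) # ks) - depth (fill ((a + b - 1) # ks) fs))"
      "weight (a # b # ks) - weight (fill ((a + b - 1) # ks) fs) =
      Suc (weight ((a + b - 1) # ks) - weight (fill ((a + b - 1) # ks) fs))" for fs
    using fill_bounds[OF idx(2), of fs] idx(3,4) by (auto simp: Suc_diff_le)
  have len: "length (a # b # ks) - 1 = Suc (length ks)" "length (c # ks) - 1 = length ks" for c
    by simp_all
  show ?thesis
    unfolding interpolate_def len sum_filling_Suc fill.simps plus minus
    unfolding sum_distrib_left by (simp add: X smult_monom mult_ac const_mult add.assoc del: mult_pCons_left)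
qed

text \<open>The part of the truncated sum with m_1 = M + 1; the empty index has no such part, hence
  the value 0.\<close>

definition zeta_head :: "nat \<Rightarrow> nat list \<Rightarrow> rat fps" where
  "zeta_head M ks = (case ks of [] \<Rightarrow> 0 | k # ks' \<Rightarrow> zeta_factor k (Suc M) * zeta_trunc M ks')"

lemma zeta_trunc_Suc: "zeta_trunc (Suc M) = (\<lambda>ks. zeta_trunc M ks + zeta_head M ks)"
  by (auto simp: zeta_head_def fun_eq_iff split: list.splits)

text \<open>After an entry at m = M + 1 the next one sits at the same m, weighted by t, or at a
  smaller one. In the induction the two merges combine, by \<open>zeta_factor_stuffle\<close>, into
  a product of separate factors.\<close>

lemma interpolate_zeta_head_Cons:
  assumes "is_index (a # ks)"
  shows "interpolate (zeta_head M) (a # ks) = [:zeta_factor a (Suc M):] *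
    ([:0, 1:] * interpolate (zeta_head M) ks + interpolate (zeta_trunc M) ks)"
  using assms
proof (induction ks arbitrary: a)
  case Nil
  then show ?case by (simp add: zeta_head_def)
next
  case (Cons b ks)
  define T where "T = [:0, 1:] * interpolate (zeta_head M) ks + interpolate (zeta_trunc M) ks"
  define t :: "rat fps poly" where "t = [:0, 1:]"
  have idx: "is_index ((a + b) # ks)" "is_index ((a + b - 1) # ks)" "1 \<le> a" "1 \<le> b" "is_index (b # ks)"
    using Cons.prems by (auto simp: is_index_def)
  note IH = Cons.IH[folded T_def]
  have stuffle: "[:zeta_factor (a + b) (Suc M):] + [:1 - fps_X:] * [:zeta_factor (a + b - 1) (Suc M):] =
      [:zeta_factor a (Suc M):] * [:zeta_factor b (Suc M):]"
    using zeta_factor_stuffle[OF idx(3,4), of "Suc M"] by (simp add: mult.commute)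
  have head: "interpolate (\<lambda>ps. zeta_head M (a # ps)) (b # ks) =
      [:zeta_factor a (Suc M):] * interpolate (zeta_trunc M) (b # ks)"
    by (simp add: zeta_head_def interpolate_cmult)
  have "interpolate (zeta_head M) (a # b # ks) =
      [:zeta_factor a (Suc M):] * interpolate (zeta_trunc M) (b # ks) +
      t * (([:zeta_factor (a + b) (Suc M):] + [:1 - fps_X:] * [:zeta_factor (a + b - 1) (Suc M):]) * T)"
    unfolding interpolate_Cons_Cons[OF Cons.prems] head IH[OF idx(1)] IH[OF idx(2)] t_def[symmetric]
    by (simp only: algebra_simps)
  also have "\<dots> = [:zeta_factor a (Suc M):] *
      (t * interpolate (zeta_head M) (b # ks) + interpolate (zeta_trunc M) (b # ks))"
    unfolding stuffle IH[OF idx(5)] by (simp only: algebra_simps)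
  finally show ?case unfolding t_def .
qed

section \<open>Index sets of full 1-height\<close>

definition index_lists :: "nat \<Rightarrow> nat \<Rightarrow> nat list set" where
  "index_lists a b = {ks. length ks = b \<and> (\<forall>k\<in>set ks. 2 \<le> k) \<and> weight ks = a + 2 * b}"

lemma one_height_eq_length_iff: "one_height ks = length ks \<longleftrightarrow> (\<forall>k\<in>set ks. 2 \<le> k)"
proof -
  let ?J = "{j. j < length ks \<and> 2 \<le> ks ! j}"
  have "card ?J = card {..<length ks} \<longleftrightarrow> ?J = {..<length ks}"
    using card_subset_eq[of "{..<length ks}" ?J] by (metis (no_types, lifting) finite_lessThan lessThan_iff mem_Collect_eq subsetI)
  also have "\<dots> \<longleftrightarrow> (\<forall>k\<in>set ks. 2 \<le> k)"
    unfolding all_set_conv_all_nth by blast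
  finally show ?thesis by (simp add: one_height_def)
qed

lemma weight_ge: "\<forall>k\<in>set ks. 2 \<le> k \<Longrightarrow> 2 * length ks \<le> weight ks"
  by (induction ks) auto

text \<open>Full 1-height means that all entries are at least 2. For \<open>l = 0\<close> the empty
  index lies in \<open>index_lists 0 0\<close> but is not admissible.\<close>

lemma I0_eq_index_lists:
  assumes "0 < l"
  shows "I0 (a + 2 * l) l l = index_lists a l"
proof (intro equalityI subsetI)
  fix ks assume "ks \<in> I0 (a + 2 * l) l l"
  then show "ks \<in> index_lists a l"
    using one_height_eq_length_iff[of ks] by (simp add: I0_def index_lists_def)
next
  fix ks assume "ks \<in> index_lists a l"
  then show "ks \<in> I0 (a + 2 * l) l l"
    using one_height_eq_length_iff[of ks] assms
    by (cases ks) (auto simp: I0_def index_lists_def is_index_def admissible_def)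
qed

text \<open>Here the truncated difference \<open>k - 2 * l\<close> is 0; emptiness keeps such pairs
  from contributing to the power u1^0.\<close>

lemma I0_empty_if_less: "k < 2 * l \<Longrightarrow> I0 k l l = {}"
  using one_height_eq_length_iff weight_ge by (fastforce simp: I0_def)

lemma I0_0 [simp]: "I0 k 0 0 = {}"
  by (auto simp: I0_def admissible_def)

lemma index_lists_0: "index_lists a 0 = (if a = 0 then {[]} else {})"
  by (auto simp: index_lists_def)

lemma index_lists_Suc: "index_lists a (Suc b) = (\<Union>i\<le>a. Cons (i + 2) ` index_lists (a - i) b)"
proof (intro equalityI subsetI)
  fix ks assume "ks \<in> index_lists a (Suc b)"
  then obtain k ks' where ks: "ks = k # ks'" "length ks' = b" "2 \<le> k" "\<forall>k\<in>set ks'. 2 \<le> k"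
      "k + weight ks' = a + 2 * Suc b"
    by (cases ks) (auto simp: index_lists_def)
  have "2 * b \<le> weight ks'"
    using weight_ge[OF ks(4)] ks(2) by simp
  then have "k - 2 \<le> a" "ks' \<in> index_lists (a - (k - 2)) b" "ks = ((k - 2) + 2) # ks'"
    using ks by (auto simp: index_lists_def)
  then show "ks \<in> (\<Union>i\<le>a. Cons (i + 2) ` index_lists (a - i) b)"
    by blast
qed (auto simp: index_lists_def)

lemma finite_index_lists: "finite (index_lists a b)"
  by (induction b arbitrary: a) (auto simp: index_lists_0 index_lists_Suc)

lemma sum_index_lists_Suc:
  "(\<Sum>ks\<in>index_lists a (Suc b). g ks) = (\<Sum>i\<le>a. \<Sum>ks\<in>index_lists (a - i) b. g ((i + 2) # ks))"
  unfolding index_lists_Suc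
  by (subst sum.UNION_disjoint) (auto simp: finite_index_lists sum.reindex)

section \<open>Generating series and their recursion in \<open>M\<close>\<close>

definition gen_ser :: "(nat list \<Rightarrow> rat fps) \<Rightarrow> ser" where
  "gen_ser \<phi> = Abs_fps (\<lambda>b. Abs_fps (\<lambda>a. \<Sum>ks\<in>index_lists a b. interpolate \<phi> ks))"

lemma gen_ser_nth: "gen_ser \<phi> $ b $ a = (\<Sum>ks\<in>index_lists a b. interpolate \<phi> ks)"
  by (simp add: gen_ser_def)

lemma gen_ser_zeta_trunc_Suc: "gen_ser (zeta_trunc (Suc M)) = gen_ser (zeta_trunc M) + gen_ser (zeta_head M)"
  by (simp add: fps_eq_iff gen_ser_nth zeta_trunc_Suc interpolate_add sum.distrib)

lemma gen_ser_zeta_trunc_0: "gen_ser (zeta_trunc 0) = 1"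
proof -
  have "interpolate (zeta_trunc 0) (k # ks) = 0" for k ks
  proof -
    have "zeta_trunc 0 (fill (k # ks) fs) = 0" for fs
      by (cases "fill (k # ks) fs") auto
    then show ?thesis by (simp add: interpolate_def)
  qed
  then have "gen_ser (zeta_trunc 0) $ b $ a = (1 :: ser) $ b $ a" for a b
    by (cases b) (simp_all add: gen_ser_nth sum_index_lists_Suc index_lists_0)
  then show ?thesis by (simp add: fps_eq_iff)
qed

text \<open>Summing over the first entry i + 2 gives u3 times a geometric series with value (x^2 +
  (1 - q) x)/(1 - u1 x); the factor 1 - u1 x clears the denominator.\<close>

lemma gen_ser_zeta_head:
  defines "x \<equiv> \<lambda>M. cst [:q_pow (Suc M):]"
  shows "(1 - u1 * x M) * gen_ser (zeta_head M) = u3 * (x M ^ 2 + (1 - q_ser) * x M) *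
    (t_ser * gen_ser (zeta_head M) + gen_ser (zeta_trunc M))"
proof -
  define p where "p = q_pow (Suc M)"
  define A :: "rat fps poly fps" where "A = Abs_fps (\<lambda>i. [:zeta_factor (i + 2) (Suc M):])"
  define R where "R = t_ser * gen_ser (zeta_head M) + gen_ser (zeta_trunc M)"
  have A_nth: "A $ i = [:p ^ Suc i * (p + (1 - fps_X)):]" for i
    by (simp add: A_def zeta_factor_eq p_def)
  have head: "gen_ser (zeta_head M) = u3 * (fps_const A * R)"
  proof -
    have "gen_ser (zeta_head M) $ b $ a = (u3 * (fps_const A * R)) $ b $ a" for a b
    proof (cases b)
      case 0
      then show ?thesis
        by (simp add: gen_ser_nth index_lists_0 u3_def zeta_head_def)
    next
      case (Suc b')
      have "interpolate (zeta_head M) ((i + 2) # ks) = A $ i *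
          ([:0, 1:] * interpolate (zeta_head M) ks + interpolate (zeta_trunc M) ks)"
        if "ks \<in> index_lists (a - i) b'" for i ks
        using that unfolding A_def fps_nth_Abs_fps
        by (intro interpolate_zeta_head_Cons) (force simp: index_lists_def is_index_def)
      then have "gen_ser (zeta_head M) $ b $ a = (\<Sum>i\<le>a. A $ i * (\<Sum>ks\<in>index_lists (a - i) b'.
          [:0, 1:] * interpolate (zeta_head M) ks + interpolate (zeta_trunc M) ks))"
        unfolding Suc gen_ser_nth sum_index_lists_Suc sum_distrib_left
        by (intro sum.cong refl) blast
      also have "\<dots> = (u3 * (fps_const A * R)) $ b $ a"
        by (simp add: Suc u3_def R_def fps_mult_nth[of A] t_ser_def cst_mult_nth gen_ser_nth
            sum.distrib sum_distrib_left atLeast0AtMost del: mult_pCons_left)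
      finally show ?thesis .
    qed
    then show ?thesis by (simp add: fps_eq_iff)
  qed
  have "(1 - fps_X * fps_const [:p:]) * A = fps_const [:p ^ 2 + (1 - fps_X) * p:]"
  proof (rule fps_ext)
    fix n
    show "((1 - fps_X * fps_const [:p:]) * A) $ n = fps_const [:p ^ 2 + (1 - fps_X) * p:] $ n"
      unfolding left_diff_distrib mult.assoc mult_1_left
      by (cases n) (simp_all add: A_nth power2_eq_square, simp_all add: algebra_simps)
  qed
  moreover have "(1 - fps_const c * fps_const d) * fps_const A = fps_const ((1 - c * d) * A)"
    for c d :: "rat fps poly fps"
    by (simp flip: fps_const_mult fps_const_sub)
  ultimately have "(1 - u1 * x M) * fps_const A = cst [:p ^ 2 + (1 - fps_X) * p:]"
    unfolding u1_def x_def cst_def p_def by (simp only:)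
  also have "\<dots> = x M ^ 2 + (1 - q_ser) * x M"
    by (simp add: x_def q_ser_def p_def power2_eq_square cst_mult[symmetric] cst_add[symmetric] cst_diff[symmetric] one_pCons mult.commute flip: cst_1)
  finally have A: "(1 - u1 * x M) * fps_const A = x M ^ 2 + (1 - q_ser) * x M" .
  have "(1 - u1 * x M) * gen_ser (zeta_head M) = u3 * ((1 - u1 * x M) * fps_const A) * R"
    unfolding head by (simp only: mult_ac)
  then show ?thesis
    unfolding A R_def .
qed

text \<open>Writing G(M+1) = G(M) + H and eliminating H by \<open>gen_ser_zeta_head\<close> leaves
  the quadratics (1 - w1 x)(1 - w2 x) and (1 - z1 x)(1 - z2 x).\<close>

lemma gen_ser_zeta_trunc_step:
  fixes M :: nat
  defines "x \<equiv> cst [:q_pow (Suc M):]"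
  shows "(1 - ((u1 + t_ser * (1 - q_ser) * u3) * x - (- (t_ser * u3)) * x ^ 2)) * gen_ser (zeta_trunc (Suc M)) =
    (1 - ((u1 - (1 - t_ser) * (1 - q_ser) * u3) * x - (1 - t_ser) * u3 * x ^ 2)) * gen_ser (zeta_trunc M)"
  using gen_ser_zeta_head[of M]
  unfolding x_def[symmetric] gen_ser_zeta_trunc_Suc
  by (simp add: algebra_simps power2_eq_square)

section \<open>From truncated sums to \<open>zeta_q\<close>\<close>

lemma const_poly_dvd_interpolate_diff:
  assumes "\<And>fs. c dvd \<phi> (fill ks fs) - \<psi> (fill ks fs)"
  shows "[:c:] dvd interpolate \<phi> ks - interpolate \<psi> ks"
  unfolding interpolate_def sum_subtractf[symmetric] diff_monom right_diff_distrib[symmetric]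
proof (rule dvd_sum)
  fix fs
  have "[:c:] dvd monom a n" if "c dvd a" for a n
    using that by (auto simp: const_poly_dvd_iff)
  then show "[:c:] dvd monom ((1 - fps_X) ^ (weight ks - weight (fill ks fs)) *
      (\<phi> (fill ks fs) - \<psi> (fill ks fs))) (depth ks - depth (fill ks fs))"
    using assms by simp
qed

lemma gen_ser_zeta_q_cong:
  "cong_upto d [:fps_X ^ Suc M:] (gen_ser zeta_q) (gen_ser (zeta_trunc M))"
  unfolding cong_upto_def gen_ser_nth sum_subtractf[symmetric]
proof (intro allI impI dvd_sum const_poly_dvd_interpolate_diff zeta_q_cong_zeta_trunc fill_ge_2)
  fix a b ks
  assume "ks \<in> index_lists a b"
  then show "\<forall>k\<in>set ks. 2 \<le> k" by (simp add: index_lists_def)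
qed

text \<open>A polynomial in t whose coefficients are divisible by every power of q is zero.\<close>

lemma cong_upto_eqI_q_adic:
  assumes "\<And>d M. 0 < d \<Longrightarrow> cong_upto d [:fps_X ^ Suc M:] F G"
  shows "F = (G :: ser)"
proof -
  have "F $ b $ a - G $ b $ a = 0" for a b
  proof -
    have "coeff (F $ b $ a - G $ b $ a) i $ n = 0" for i n
    proof -
      have "[:fps_X ^ Suc n:] dvd F $ b $ a - G $ b $ a"
        using assms[of "Suc (a + b)" n] unfolding cong_upto_def by blast
      then have "fps_X ^ Suc n dvd coeff (F $ b $ a - G $ b $ a) i"
        unfolding const_poly_dvd_iff by blast
      then show ?thesis unfolding fps_X_power_dvd_iff by blast
    qed
    then show ?thesis by (simp add: poly_eq_iff fps_eq_iff)
  qed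
  then show ?thesis by (simp add: fps_eq_iff)
qed

text \<open>The monomial u1^a u3^b arises only from \<open>(k, l) = (a + 2 * b, b)\<close>; the
  subtracted 1 is the contribution of the empty index.\<close>

lemma generating_series_eq_gen_ser:
  "formal_sum (\<lambda>(k, l). cst (\<Sum>ks \<in> I0 k l l. zeta_qt ks) * u1 ^ (k - 2 * l) * u3 ^ l) UNIV =
    gen_ser zeta_q - 1"
proof -
  define f where "f = (\<lambda>(k, l). cst (\<Sum>ks \<in> I0 k l l. zeta_qt ks) * u1 ^ (k - 2 * l) * u3 ^ l)"
  have f_nth: "f (k, l) $ b $ a =
      (if b = l \<and> a = k - 2 * l then \<Sum>ks \<in> I0 k l l. zeta_qt ks else 0)" for k l a b
  proof -
    have "f (k, l) = cst (\<Sum>ks \<in> I0 k l l. zeta_qt ks) * (fps_const (fps_X ^ (k - 2 * l)) * fps_X ^ l)"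
      by (simp add: f_def u1_def u3_def mult.assoc)
    then show ?thesis
      unfolding cst_mult_nth by (simp only:) (simp add: cst_mult_nth)
  qed
  have "formal_sum f UNIV $ b $ a = (gen_ser zeta_q - 1) $ b $ a" for a b
  proof -
    have "(\<Sum>i\<in>{i \<in> UNIV. f i $ b $ a \<noteq> 0}. f i $ b $ a) = (\<Sum>i\<in>{(a + 2 * b, b)}. f i $ b $ a)"
    proof (rule sum.mono_neutral_left)
      have "k = a + 2 * b \<and> l = b" if "f (k, l) $ b $ a \<noteq> 0" for k l
        using that I0_empty_if_less[of k l] by (cases "k < 2 * l") (auto simp: f_nth split: if_splits)
      then show "{i \<in> UNIV. f i $ b $ a \<noteq> 0} \<subseteq> {(a + 2 * b, b)}" by auto
    qed auto
    then have "formal_sum f UNIV $ b $ a = (\<Sum>ks \<in> I0 (a + 2 * b) b b. zeta_qt ks)"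
      by (simp add: formal_sum_def f_nth)
    also have "\<dots> = (gen_ser zeta_q - 1) $ b $ a"
    proof (cases "b = 0")
      case True
      have "zeta_q [] = 1"
        by (simp add: zeta_q_def infsum_finite Collect_conv_if cong: conj_cong)
      then show ?thesis using True by (simp add: gen_ser_nth index_lists_0)
    next
      case False
      then show ?thesis
        by (simp add: I0_eq_index_lists gen_ser_nth zeta_qt_eq_interpolate)
    qed
    finally show ?thesis .
  qed
  then show ?thesis unfolding f_def by (simp add: fps_eq_iff)
qed

subsection \<open>The exponent\<close>

lemma order_ge_1_iff: "order_ge 1 F \<longleftrightarrow> F $ 0 $ 0 = 0"
  by (simp add: cong_upto_def)

text \<open>Each summand is x^n r^(K-n) - x^(n-1) r^(K-n+1). The start at n = 2 leaves the boundary
  term r^(K-1) x.\<close>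

lemma sum_telescope_power:
  fixes x r :: "'a::comm_ring_1"
  assumes "1 \<le> K"
  shows "(\<Sum>n=2..<Suc K. x ^ (n - 1) * (x - r) * r ^ (K - n)) = x ^ K - r ^ (K - 1) * x"
  using assms
proof (induction K rule: dec_induct)
  case (step K)
  have "(\<Sum>n=2..<Suc (Suc K). x ^ (n - 1) * (x - r) * r ^ (Suc K - n)) =
      r * (\<Sum>n=2..<Suc K. x ^ (n - 1) * (x - r) * r ^ (K - n)) + x ^ K * (x - r)"
  proof -
    have "x ^ (n - 1) * (x - r) * r ^ (Suc K - n) = r * (x ^ (n - 1) * (x - r) * r ^ (K - n))"
      if "n \<in> {2..<Suc K}" for n
      using that by (simp add: Suc_diff_le mult_ac)
    then have "(\<Sum>n=2..<Suc K. x ^ (n - 1) * (x - r) * r ^ (Suc K - n)) =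
        r * (\<Sum>n=2..<Suc K. x ^ (n - 1) * (x - r) * r ^ (K - n))"
      unfolding sum_distrib_left by (rule sum.cong[OF refl])
    then show ?thesis
      using step(1) by (subst sum.atLeastLessThan_Suc) simp_all
  qed
  also have "\<dots> = x ^ Suc K - r ^ (Suc K - 1) * x"
    unfolding step(3) using step(1) by (cases K) (simp_all add: algebra_simps)
  finally show ?case .
qed simp

text \<open>Raising \<open>K\<close> by one adds exactly the diagonal m + n = K, to which
  \<open>sum_telescope_power\<close> applies.\<close>

lemma sum_telescope_power_double:
  fixes x r :: "'a::comm_ring_1"
  shows "(\<Sum>n=2..<K. x ^ (n - 1) * (x - r) * (\<Sum>m<K - n. r ^ m * f (m + n))) =
    (\<Sum>n=1..<K. (x ^ n - r ^ (n - 1) * x) * f n)"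
proof (induction K)
  case (Suc K)
  show ?case
  proof (cases "1 \<le> K")
    case True
    have "(\<Sum>n=2..<Suc K. x ^ (n - 1) * (x - r) * (\<Sum>m<Suc K - n. r ^ m * f (m + n))) =
        (\<Sum>n=2..<Suc K. x ^ (n - 1) * (x - r) * (\<Sum>m<K - n. r ^ m * f (m + n)) +
          x ^ (n - 1) * (x - r) * r ^ (K - n) * f K)"
      by (rule sum.cong) (auto simp: Suc_diff_le algebra_simps)
    also have "\<dots> = (\<Sum>n=2..<Suc K. x ^ (n - 1) * (x - r) * (\<Sum>m<K - n. r ^ m * f (m + n))) +
        (\<Sum>n=2..<Suc K. x ^ (n - 1) * (x - r) * r ^ (K - n)) * f K"
      by (simp only: sum.distrib sum_distrib_right)
    also have "(\<Sum>n=2..<Suc K. x ^ (n - 1) * (x - r) * (\<Sum>m<K - n. r ^ m * f (m + n))) =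
        (\<Sum>n=2..<K. x ^ (n - 1) * (x - r) * (\<Sum>m<K - n. r ^ m * f (m + n)))"
      by (rule sum.mono_neutral_right) auto
    finally show ?thesis
      unfolding sum_telescope_power[OF True] Suc using True by simp
  qed simp
qed simp

lemma zeta_trunc_single: "zeta_trunc M [n] = (\<Sum>m<M. zeta_factor n (Suc m))"
  by (induction M) simp_all

section \<open>The two quadratics and their logarithms\<close>

definition w_sum :: ser where "w_sum = u1 + t_ser * (1 - q_ser) * u3"
definition w_prod :: ser where "w_prod = - (t_ser * u3)"
definition z_sum :: ser where "z_sum = u1 - (1 - t_ser) * (1 - q_ser) * u3"
definition z_prod :: ser where "z_prod = (1 - t_ser) * u3"

text \<open>In the extension \<open>1 - w_quad x\<close> becomes (1 - w1 x)(1 - w2 x), and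
  \<open>1 - z_quad x\<close> likewise.\<close>

definition w_quad :: "ser \<Rightarrow> ser" where "w_quad x = w_sum * x - w_prod * x ^ 2"
definition z_quad :: "ser \<Rightarrow> ser" where "z_quad x = z_sum * x - z_prod * x ^ 2"

lemma order_ge_wz:
  "order_ge 1 w_sum" "order_ge 1 w_prod" "order_ge 1 z_sum" "order_ge 1 z_prod"
  unfolding order_ge_1_iff
  by (simp_all add: w_sum_def w_prod_def z_sum_def z_prod_def u1_def u3_def)

lemma order_ge_quad: "order_ge 1 (w_quad x)" "order_ge 1 (z_quad x)"
  unfolding w_quad_def z_quad_def
  using order_ge_wz unfolding order_ge_1_iff by simp_all

lemma w_quad_eq_z_quad: "w_quad (q_ser - 1) = z_quad (q_ser - 1)"
  by (simp add: w_quad_def z_quad_def w_sum_def z_sum_def w_prod_def z_prod_def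
      algebra_simps power2_eq_square)

text \<open>Shifted by one, so that \<open>m < M\<close> runs over x_1, ..., x_M.\<close>

definition q_pow_ser :: "nat \<Rightarrow> ser" where "q_pow_ser m = cst [:q_pow (Suc m):]"

text \<open>The truncated logarithm of (1 - z_quad x)/(1 - w_quad x).\<close>

definition log_ratio :: "nat \<Rightarrow> ser \<Rightarrow> ser" where
  "log_ratio d x = log_trunc d (w_quad x) - log_trunc d (z_quad x)"

lemma order_ge_log_ratio: "order_ge 1 (log_ratio d x)"
  unfolding log_ratio_def
  using cong_upto_diff[OF order_ge_log_trunc[OF order_ge_quad(1)] order_ge_log_trunc[OF order_ge_quad(2)]]
  by simp

lemma exp_trunc_log_ratio:
  "cong_upto d 0 (exp_trunc d (log_ratio d x) * (1 - w_quad x)) (1 - z_quad x)"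
proof -
  let ?lw = "log_trunc d (w_quad x)" and ?lz = "log_trunc d (z_quad x)"
  have "order_ge 1 (- ?lz)"
    using cong_upto_uminus[OF order_ge_log_trunc[OF order_ge_quad(2)]] by simp
  from exp_trunc_add[OF order_ge_log_trunc[OF order_ge_quad(1)] this]
  have "cong_upto d 0 (exp_trunc d (log_ratio d x)) (exp_trunc d ?lw * exp_trunc d (- ?lz))"
    by (simp add: log_ratio_def)
  then have "cong_upto d 0 (exp_trunc d (log_ratio d x) * (1 - w_quad x))
      (exp_trunc d ?lw * exp_trunc d (- ?lz) * (1 - w_quad x))"
    by (rule cong_upto_mult[OF _ cong_upto_refl])
  also have "exp_trunc d ?lw * exp_trunc d (- ?lz) * (1 - w_quad x) =
      (exp_trunc d ?lw * (1 - w_quad x)) * exp_trunc d (- ?lz)"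
    by (simp only: mult_ac)
  also have "cong_upto d 0 \<dots> (1 * (1 - z_quad x))"
    by (intro cong_upto_mult exp_trunc_log_trunc exp_trunc_uminus_log_trunc order_ge_quad)
  finally show ?thesis by simp
qed

text \<open>Each step in \<open>M\<close> multiplies by one ratio of quadratics; the exponential
  turns the product into a sum of logarithms.\<close>

lemma gen_ser_zeta_trunc_cong_exp_trunc:
  assumes "0 < d"
  shows "cong_upto d 0 (gen_ser (zeta_trunc M)) (exp_trunc d (\<Sum>m<M. log_ratio d (q_pow_ser m)))"
proof (induction M)
  case 0
  show ?case using assms by (simp add: gen_ser_zeta_trunc_0 exp_trunc_0)
next
  case (Suc M)
  define x where "x = q_pow_ser M"
  let ?lw = "exp_trunc d (log_trunc d (w_quad x))" and ?G = "\<lambda>M. gen_ser (zeta_trunc M)"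
  let ?S = "\<Sum>m<M. log_ratio d (q_pow_ser m)"
  have S: "order_ge 1 ?S"
    by (intro order_ge_sum order_ge_log_ratio)
  have step: "(1 - w_quad x) * ?G (Suc M) = (1 - z_quad x) * ?G M"
    using gen_ser_zeta_trunc_step[of M]
    by (simp only: x_def q_pow_ser_def w_quad_def z_quad_def w_sum_def z_sum_def w_prod_def z_prod_def)
  have inv: "cong_upto d 0 (?lw * (1 - w_quad x)) 1"
    by (rule exp_trunc_log_trunc[OF order_ge_quad(1)])
  \<comment> \<open>\<open>?lw\<close> acts as the inverse of \<open>1 - w_quad x\<close>, so
    multiplying by it isolates \<open>?G (Suc M)\<close>.\<close>
  have "cong_upto d 0 (1 * ?G (Suc M)) (?lw * (1 - w_quad x) * ?G (Suc M))"
    by (intro cong_upto_mult cong_upto_refl cong_upto_sym[OF inv])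
  also have "?lw * (1 - w_quad x) * ?G (Suc M) = ?lw * (1 - z_quad x) * ?G M"
    by (simp only: mult.assoc step)
  also have "cong_upto d 0 \<dots> (?lw * (exp_trunc d (log_ratio d x) * (1 - w_quad x)) * ?G M)"
    by (intro cong_upto_mult cong_upto_refl cong_upto_sym[OF exp_trunc_log_ratio])
  also have "?lw * (exp_trunc d (log_ratio d x) * (1 - w_quad x)) * ?G M =
      (?lw * (1 - w_quad x)) * (?G M * exp_trunc d (log_ratio d x))"
    by (simp only: mult_ac)
  also have "cong_upto d 0 \<dots> (1 * (exp_trunc d ?S * exp_trunc d (log_ratio d x)))"
    by (intro cong_upto_mult cong_upto_refl inv Suc)
  also have "cong_upto d 0 \<dots> (exp_trunc d (?S + log_ratio d x))"
    unfolding mult_1_left by (rule cong_upto_sym[OF exp_trunc_add[OF S order_ge_log_ratio]])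
  finally show ?case by (simp add: x_def)
qed

text \<open>The P(N) of the theorem, written through sums and products of the roots so that it lies
  in \<open>ser\<close>.\<close>

definition wz_power_sum :: "nat \<Rightarrow> ser" where
  "wz_power_sum n = power_sum w_sum w_prod n - power_sum z_sum z_prod n"

lemma order_ge_wz_power_sum:
  assumes "2 * d \<le> n"
  shows "order_ge d (wz_power_sum n)"
proof -
  have "order_ge ((n + 1) div 2) (wz_power_sum n)"
    unfolding wz_power_sum_def
    using cong_upto_diff[OF order_ge_power_sum[OF order_ge_wz(1,2)] order_ge_power_sum[OF order_ge_wz(3,4)]]
    by simp
  then show ?thesis
    by (rule cong_upto_mono) (use assms in simp)
qed

lemma wz_power_sum_series_cong:
  "cong_upto d 0 (\<Sum>n=1..<2*d. x ^ n * (rat_cst (1 / of_nat n) * wz_power_sum n)) (log_ratio d x)"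
proof -
  have "(\<Sum>n=1..<2*d. x ^ n * (rat_cst (1 / of_nat n) * wz_power_sum n)) =
      (\<Sum>n=1..<2*d. rat_cst (1 / of_nat n) * power_sum w_sum w_prod n * x ^ n) -
      (\<Sum>n=1..<2*d. rat_cst (1 / of_nat n) * power_sum z_sum z_prod n * x ^ n)"
    by (simp add: wz_power_sum_def algebra_simps flip: sum_subtractf)
  then show ?thesis
    unfolding log_ratio_def w_quad_def z_quad_def
    by (simp only:) (intro cong_upto_diff power_sum_series_cong_log_trunc order_ge_wz)
qed

text \<open>At \<open>x = q - 1\<close> the two quadratics agree because \<open>x\<^sup>2 + (1 - q) x = 0\<close>, so the boundary terms
  left over by the telescoping sum over \<open>n\<close> cancel.\<close>

lemma order_ge_boundary_terms:
  "order_ge d (\<Sum>n=1..<2*d. (q_ser - 1) ^ (n - 1) * (rat_cst (1 / of_nat n) * wz_power_sum n))"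
  (is "order_ge d ?B")
proof -
  have "(q_ser - 1) * ?B = (\<Sum>n=1..<2*d. (q_ser - 1) ^ n * (rat_cst (1 / of_nat n) * wz_power_sum n))"
    unfolding sum_distrib_left
  proof (rule sum.cong[OF refl])
    fix n assume "n \<in> {1..<2*d}"
    then show "(q_ser - 1) * ((q_ser - 1) ^ (n - 1) * (rat_cst (1 / of_nat n) * wz_power_sum n)) =
        (q_ser - 1) ^ n * (rat_cst (1 / of_nat n) * wz_power_sum n)"
      by (cases n) (simp_all only: power_Suc mult.assoc, simp_all)
  qed
  then have "order_ge d ((q_ser - 1) * ?B)"
    using wz_power_sum_series_cong[of d "q_ser - 1"] by (simp add: log_ratio_def w_quad_eq_z_quad)
  \<comment> \<open>The factor q - 1 can be cancelled coefficientwise, being a nonzero constant over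
    an integral domain.\<close>
  moreover have "q_ser - 1 = cst [:fps_X - 1:]"
    by (simp add: q_ser_def one_pCons flip: cst_1 cst_diff)
  moreover have "(fps_X :: rat fps) - 1 \<noteq> 0"
    by (metis fps_X_neq_one right_minus_eq)
  ultimately show ?thesis
    by (simp add: cong_upto_def cst_mult_nth del: mult_pCons_left)
qed

section \<open>Reduction of the exponent to finite sums\<close>

definition exponent :: ser where
  "exponent = formal_sum (\<lambda>n. cst [:zeta_q [n]:] *
    formal_sum (\<lambda>m. (q_ser - 1) ^ m * rat_cst (1 / of_nat (m + n)) * wz_power_sum (m + n)) UNIV) {2..}"

text \<open>P(m + n) has order at least \<open>d\<close> once \<open>m + n >= 2 * d\<close>, so
  finitely many pairs matter below degree \<open>d\<close>.\<close>

lemma exponent_cong_finite_sum: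
  "cong_upto d 0 exponent (\<Sum>n=2..<2*d. cst [:zeta_q [n]:] *
    (\<Sum>m<2*d-n. (q_ser - 1) ^ m * (rat_cst (1 / of_nat (m + n)) * wz_power_sum (m + n))))"
proof -
  have inner: "cong_upto d 0
      (formal_sum (\<lambda>m. (q_ser - 1) ^ m * rat_cst (1 / of_nat (m + n)) * wz_power_sum (m + n)) UNIV)
      (\<Sum>m<2*d-n. (q_ser - 1) ^ m * rat_cst (1 / of_nat (m + n)) * wz_power_sum (m + n))" for n
    by (rule formal_sum_cong_upto) (auto intro!: order_ge_mult_left order_ge_wz_power_sum)
  have "cong_upto d 0 exponent (\<Sum>n=2..<2*d. cst [:zeta_q [n]:] *
      formal_sum (\<lambda>m. (q_ser - 1) ^ m * rat_cst (1 / of_nat (m + n)) * wz_power_sum (m + n)) UNIV)"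
    unfolding exponent_def
  proof (rule formal_sum_cong_upto)
    fix n assume "n \<in> {2..} - {2..<2*d}"
    then have "2 * d - n = 0" by auto
    with inner[of n] show "order_ge d (cst [:zeta_q [n]:] *
        formal_sum (\<lambda>m. (q_ser - 1) ^ m * rat_cst (1 / of_nat (m + n)) * wz_power_sum (m + n)) UNIV)"
      by (intro order_ge_mult_left) simp
  qed auto
  also have "cong_upto d 0 \<dots> (\<Sum>n=2..<2*d. cst [:zeta_q [n]:] *
      (\<Sum>m<2*d-n. (q_ser - 1) ^ m * rat_cst (1 / of_nat (m + n)) * wz_power_sum (m + n)))"
    by (intro cong_upto_sum cong_upto_mult cong_upto_refl inner)
  finally show ?thesis by (simp only: mult.assoc)
qed

lemma order_ge_exponent: "order_ge 1 exponent"
  using exponent_cong_finite_sum[of 1] by simp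

text \<open>Writing 1 - q as -(q - 1) gives the shape x^(n-1) (x - r) needed for telescoping with r
  = q - 1.\<close>

lemma cst_zeta_trunc_single:
  assumes "1 \<le> n"
  shows "cst [:zeta_trunc M [n]:] = (\<Sum>m<M. q_pow_ser m ^ (n - 1) * (q_pow_ser m - (q_ser - 1)))"
proof -
  have "cst [:zeta_factor n (Suc m):] = q_pow_ser m ^ (n - 1) * (q_pow_ser m - (q_ser - 1))" for m
  proof -
    have "[:zeta_factor n (Suc m):] = [:q_pow (Suc m):] ^ (n - 1) * ([:q_pow (Suc m):] - ([:fps_X:] - 1))"
      using assms by (simp add: zeta_factor_eq one_pCons mult.commute poly_const_pow)
    then show ?thesis
      by (simp add: q_pow_ser_def q_ser_def cst_mult cst_power cst_diff)
  qed
  then show ?thesis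
    by (simp add: zeta_trunc_single cst_sum flip: sum_to_poly)
qed

text \<open>Modulo q^(M+1) each zeta value is a finite sum over m, so the sums can be swapped and
  telescoped for each x_m. What is left over is x_m times the boundary sum \<open>B\<close>, which
  has order at least \<open>d\<close>.\<close>

lemma exponent_cong_log_ratio:
  "cong_upto d [:fps_X ^ Suc M:] exponent (\<Sum>m<M. log_ratio d (q_pow_ser m))"
proof -
  define r where "r = q_ser - 1"
  define f where "f n = rat_cst (1 / of_nat n) * wz_power_sum n" for n
  define B where "B = (\<Sum>n=1..<2*d. r ^ (n - 1) * f n)"
  have zeta: "cong_upto d [:fps_X ^ Suc M:] (cst [:zeta_q [n]:]) (cst [:zeta_trunc M [n]:])"
    if "2 \<le> n" for n
  proof -
    have "fps_X ^ Suc M dvd zeta_q [n] - zeta_trunc M [n]"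
      using that by (intro zeta_q_cong_zeta_trunc) simp
    then have "[:fps_X ^ Suc M:] dvd [:zeta_q [n] - zeta_trunc M [n]:]"
      by (simp add: const_poly_dvd_iff coeff_pCons split: nat.split)
    then show ?thesis
      by (simp add: cong_upto_def cst_nth)
  qed
  have "cong_upto d [:fps_X ^ Suc M:] exponent
      (\<Sum>n=2..<2*d. cst [:zeta_q [n]:] * (\<Sum>m<2*d-n. r ^ m * f (m + n)))"
    unfolding r_def f_def by (rule cong_upto_weaken[OF exponent_cong_finite_sum])
  also have "cong_upto d [:fps_X ^ Suc M:] \<dots>
      (\<Sum>n=2..<2*d. cst [:zeta_trunc M [n]:] * (\<Sum>m<2*d-n. r ^ m * f (m + n)))"
    by (intro cong_upto_sum cong_upto_mult cong_upto_refl zeta) simp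
  also have "(\<Sum>n=2..<2*d. cst [:zeta_trunc M [n]:] * (\<Sum>m<2*d-n. r ^ m * f (m + n))) =
      (\<Sum>n=2..<2*d. \<Sum>i<M. q_pow_ser i ^ (n - 1) * (q_pow_ser i - r) * (\<Sum>m<2*d-n. r ^ m * f (m + n)))"
    by (rule sum.cong) (simp_all add: cst_zeta_trunc_single r_def sum_distrib_right)
  also have "\<dots> = (\<Sum>i<M. \<Sum>n=1..<2*d. (q_pow_ser i ^ n - r ^ (n - 1) * q_pow_ser i) * f n)"
    by (subst sum.swap) (simp only: sum_telescope_power_double)
  also have "\<dots> = (\<Sum>i<M. (\<Sum>n=1..<2*d. q_pow_ser i ^ n * f n) - q_pow_ser i * B)"
    by (simp only: left_diff_distrib sum_subtractf B_def sum_distrib_left, simp only: mult_ac)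
  also have "cong_upto d [:fps_X ^ Suc M:] \<dots> (\<Sum>i<M. log_ratio d (q_pow_ser i) - 0)"
    unfolding B_def f_def r_def
    by (rule cong_upto_weaken)
      (intro cong_upto_sum cong_upto_diff wz_power_sum_series_cong order_ge_mult_left order_ge_boundary_terms)
  finally show ?thesis by simp
qed

lemma gen_ser_zeta_q_eq_exp_ser: "gen_ser zeta_q = exp_ser exponent"
proof (rule cong_upto_eqI_q_adic)
  fix d M :: nat
  assume d: "0 < d"
  have "cong_upto d [:fps_X ^ Suc M:] (gen_ser zeta_q) (gen_ser (zeta_trunc M))"
    by (rule gen_ser_zeta_q_cong)
  also have "cong_upto d [:fps_X ^ Suc M:] \<dots> (exp_trunc d (\<Sum>m<M. log_ratio d (q_pow_ser m)))"
    by (rule cong_upto_weaken[OF gen_ser_zeta_trunc_cong_exp_trunc[OF d]])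
  also have "cong_upto d [:fps_X ^ Suc M:] \<dots> (exp_trunc d exponent)"
    by (rule exp_trunc_cong_upto[OF cong_upto_sym[OF exponent_cong_log_ratio]])
  also have "cong_upto d [:fps_X ^ Suc M:] \<dots> (exp_ser exponent)"
    by (rule cong_upto_weaken[OF cong_upto_sym[OF exp_ser_cong_upto[OF order_ge_exponent]]])
  finally show "cong_upto d [:fps_X ^ Suc M:] (gen_ser zeta_q) (exp_ser exponent)" .
qed

theorem theorem2p4:
  fixes \<iota> :: "ser \<Rightarrow> 'r :: comm_ring_1" and z1 z2 w1 w2 :: 'r
  assumes "ring_embedding \<iota>" and "zw_system \<iota> z1 z2 w1 w2"
  shows "\<exists>P :: nat \<Rightarrow> ser.
    (\<forall>N. \<iota> (P N) = w1 ^ N + w2 ^ N - z1 ^ N - z2 ^ N) \<and>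
    formal_sum (\<lambda>(k, l). cst (\<Sum>ks \<in> I0 k l l. zeta_qt ks) * u1 ^ (k - 2 * l) * u3 ^ l) UNIV =
    exp_ser (formal_sum (\<lambda>n. cst [:zeta_q [n]:] *
      formal_sum (\<lambda>m. (q_ser - 1) ^ m * rat_cst (1 / of_nat (m + n)) * P (m + n)) UNIV) {2..}) - 1"
proof (intro exI[of _ wz_power_sum] conjI allI)
  fix N
  \<comment> \<open>\<open>ring_embedding\<close> speaks of sums only, so the difference is obtained
    by adding the subtrahend back.\<close>
  have "\<iota> (wz_power_sum N + power_sum z_sum z_prod N) = \<iota> (wz_power_sum N) + \<iota> (power_sum z_sum z_prod N)"
    using assms(1) by (simp only: ring_embedding_def)
  then have "\<iota> (wz_power_sum N) = \<iota> (power_sum w_sum w_prod N) - \<iota> (power_sum z_sum z_prod N)"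
    by (simp add: wz_power_sum_def)
  moreover have "\<iota> w_sum = w1 + w2" "\<iota> w_prod = w1 * w2" "\<iota> z_sum = z1 + z2" "\<iota> z_prod = z1 * z2"
    using assms(2) by (simp_all only: zw_system_def w_sum_def w_prod_def z_sum_def z_prod_def)
  ultimately show "\<iota> (wz_power_sum N) = w1 ^ N + w2 ^ N - z1 ^ N - z2 ^ N"
    by (simp add: ring_embedding_power_sum[OF assms(1)] power_sum_eq)
next
  show "formal_sum (\<lambda>(k, l). cst (\<Sum>ks \<in> I0 k l l. zeta_qt ks) * u1 ^ (k - 2 * l) * u3 ^ l) UNIV =
    exp_ser (formal_sum (\<lambda>n. cst [:zeta_q [n]:] *
      formal_sum (\<lambda>m. (q_ser - 1) ^ m * rat_cst (1 / of_nat (m + n)) * wz_power_sum (m + n)) UNIV) {2..}) - 1"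
    unfolding generating_series_eq_gen_ser gen_ser_zeta_q_eq_exp_ser exponent_def ..
qed

end
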